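(* Let $\alpha\ge 0$ and $q\in(0,1)$. If $(P_\alpha)$ has a solution $u$ such that $u>0$ in $\Omega_+^a$, then $\int_\Omega a<0$. If, in addition, $\Omega_+^a$ has finitely many connected components, all of which are smooth, and $q\in\mathcal{I}_{\mathcal N}$, then every such solution belongs to $\mathcal P^\circ$.
   Context: Let $\Omega\subset\mathbb{R}^N$ ($N\ge1$) be a bounded domain with smooth boundary, $\nu$ the unit outward normal and $\partial_\nu$ the outward normal derivative. Let $0<\theta<1$ and let $a\in C^\theta(\overline\Omega)$ change sign in $\Omega$. For $\alpha\ge0$ and $q\in(0,1)$, $(P_\alpha)$ denotes the problem $-\Delta u=a(x)u^q$ in $\Omega$, $u\ge0$ in $\Omega$, $\partial_\nu u=\alpha u$ on $\partial\Omega$. A solution of $(P_\alpha)$ is a nonnegative classical solution $u\in C^{2+r}(\overline\Omega)$ for some $r\in(0,1)$. $\Omega_+^a:=\{x\in\Omega: a(x)>0\}$, and $\mathcal P^\circ:=\{u\in C(\overline\Omega): u>0 \text{ on } \overline\Omega\}$. $\mathcal I_{\mathcal N}$ denotes the set of $q\in(0,1)$ for which $(P_0)$ has a solution in $\mathcal P^\circ$. *)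

theory Defs
  imports "HOL-Analysis.Analysis"
begin

definition holder_on :: "real \<Rightarrow> 'a::euclidean_space set \<Rightarrow> ('a \<Rightarrow> real) \<Rightarrow> bool" where
  "holder_on th S f \<longleftrightarrow> (\<exists>C. \<forall>x\<in>S. \<forall>y\<in>S. \<bar>f x - f y\<bar> \<le> C * dist x y powr th)"

inductive higher_partial :: "('a::euclidean_space \<Rightarrow> real) \<Rightarrow> ('a \<Rightarrow> real) \<Rightarrow> bool"
  for f where
  base: "higher_partial f f"
| step: "higher_partial f g \<Longrightarrow> i \<in> Basis \<Longrightarrow> (\<And>x. (g has_derivative g' x) (at x))
         \<Longrightarrow> higher_partial f (\<lambda>x. g' x i)"

definition smooth_fun :: "('a::euclidean_space \<Rightarrow> real) \<Rightarrow> bool" where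
  "smooth_fun f \<longleftrightarrow> (\<forall>g. higher_partial f g \<longrightarrow> (\<forall>x. g differentiable (at x)))"

definition grad :: "('a::euclidean_space \<Rightarrow> real) \<Rightarrow> 'a \<Rightarrow> 'a" where
  "grad f x = (\<Sum>i\<in>Basis. frechet_derivative f (at x) i *\<^sub>R i)"

text \<open>rho is a smooth global defining function of the bounded domain Omega:
  Omega = {rho < 0}, and grad rho does not vanish on {rho = 0} (which is the boundary).\<close>
definition smooth_domain :: "'a::euclidean_space set \<Rightarrow> ('a \<Rightarrow> real) \<Rightarrow> bool" where
  "smooth_domain \<Omega> \<rho> \<longleftrightarrow> open \<Omega> \<and> connected \<Omega> \<and> bounded \<Omega> \<and> \<Omega> \<noteq> {} \<and>
     smooth_fun \<rho> \<and> \<Omega> = {x. \<rho> x < 0} \<and> (\<forall>x. \<rho> x = 0 \<longrightarrow> grad \<rho> x \<noteq> 0)"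

definition outer_normal :: "('a::euclidean_space \<Rightarrow> real) \<Rightarrow> 'a \<Rightarrow> 'a" where
  "outer_normal \<rho> x = (1 / norm (grad \<rho> x)) *\<^sub>R grad \<rho> x"

text \<open>u in C^{2+r}(closure Omega), with gradient Du and Hessian D2u (extended continuously
  to the closure); returns this data.\<close>
definition C2r_data :: "real \<Rightarrow> 'a::euclidean_space set \<Rightarrow> ('a \<Rightarrow> real) \<Rightarrow> ('a \<Rightarrow> 'a)
     \<Rightarrow> ('a \<Rightarrow> 'a \<Rightarrow> 'a) \<Rightarrow> bool" where
  "C2r_data r \<Omega> u Du D2u \<longleftrightarrow>
     continuous_on (closure \<Omega>) u \<and>
     (\<forall>x\<in>\<Omega>. (u has_derivative (\<lambda>h. Du x \<bullet> h)) (at x)) \<and>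
     (\<forall>x\<in>\<Omega>. (Du has_derivative D2u x) (at x)) \<and>
     continuous_on (closure \<Omega>) Du \<and>
     (\<forall>i\<in>Basis. \<forall>j\<in>Basis. holder_on r (closure \<Omega>) (\<lambda>x. D2u x i \<bullet> j))"

definition is_solution :: "'a::euclidean_space set \<Rightarrow> ('a \<Rightarrow> real) \<Rightarrow> ('a \<Rightarrow> real)
     \<Rightarrow> real \<Rightarrow> real \<Rightarrow> ('a \<Rightarrow> real) \<Rightarrow> bool" where
  "is_solution \<Omega> \<rho> a \<alpha> q u \<longleftrightarrow>
     (\<exists>r Du D2u. 0 < r \<and> r < 1 \<and> C2r_data r \<Omega> u Du D2u \<and>
        (\<forall>x\<in>\<Omega>. u x \<ge> 0) \<and>
        (\<forall>x\<in>\<Omega>. - (\<Sum>i\<in>Basis. D2u x i \<bullet> i) = a x * u x powr q) \<and>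
        (\<forall>x\<in>frontier \<Omega>. Du x \<bullet> outer_normal \<rho> x = \<alpha> * u x))"

definition positive_cone :: "'a::euclidean_space set \<Rightarrow> ('a \<Rightarrow> real) set" where
  "positive_cone \<Omega> = {u. continuous_on (closure \<Omega>) u \<and> (\<forall>x\<in>closure \<Omega>. u x > 0)}"

definition I_N :: "'a::euclidean_space set \<Rightarrow> ('a \<Rightarrow> real) \<Rightarrow> ('a \<Rightarrow> real) \<Rightarrow> real set" where
  "I_N \<Omega> \<rho> a = {q. 0 < q \<and> q < 1 \<and> (\<exists>u. is_solution \<Omega> \<rho> a 0 q u \<and> u \<in> positive_cone \<Omega>)}"

end

theory Submission
  imports Defs "HOL-Real_Asymp.Real_Asymp"
begin

text \<open>
  Boundary integrals are avoided: only the one-sided statement is needed that a field \<open>F\<close> with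
  \<open>F \<bullet> \<nu> \<ge> 0\<close> on the boundary has \<open>\<integral> div F \<ge> 0\<close>. It follows from the vanishing of \<open>\<integral> div G\<close> for
  compactly supported \<open>G\<close> (translation invariance) by a cutoff in terms of the defining function.

  For \<open>\<integral> a < 0\<close>, apply this to \<open>F = (u + \<epsilon>) powr (- q) \<nabla>u\<close> and let \<open>\<epsilon> \<rightarrow> 0\<close>.

  For the second claim, let \<open>v\<close> be a positive solution of the Neumann problem; then \<open>u \<ge> v\<close>. With
  \<open>w = u powr (1 - q) / (1 - q)\<close>, the difference of the two equations is tested with a high power of
  the positive part of \<open>w\<^sub>v - w\<^sub>u\<close>. This forces \<open>\<nabla>u = \<nabla>v = 0\<close> where \<open>0 < u < v\<close>; since \<open>\<nabla>u = 0\<close>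
  also at the zeros of \<open>u\<close>, the function \<open>u\<close> is locally constant on \<open>{v > u}\<close>. If this set were
  nonempty, connectedness would make \<open>u\<close> constant on \<open>\<Omega>\<close>, contradicting \<open>a u\<^sup>q > 0\<close> on \<open>{a > 0}\<close>.
\<close>

section \<open>Fields and their divergence\<close>

text \<open>Lebesgue measure is translation invariant, so every difference quotient of
  \<open>g\<close> in direction \<open>i\<close> has integral zero. The mean value theorem bounds
  the quotients by \<open>B\<close>, and dominated convergence carries the value zero, together with
  integrability, over to their pointwise limit.\<close>

lemma integral_directional_derivative_eq_0:
  fixes g :: "'a::euclidean_space \<Rightarrow> real"
  assumes der: "\<And>x. (g has_derivative g' x) (at x)"
    and supp: "bounded {x. g x \<noteq> 0}"
    and bnd: "\<And>x. \<bar>g' x i\<bar> \<le> B"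
  shows "((\<lambda>x. g' x i) has_integral 0) UNIV"
proof -
  obtain R where "R > 0" and "{x. g x \<noteq> 0} \<subseteq> ball 0 R"
    using bounded_subset_ballD[OF supp, of 0] by auto
  then have zero: "g x = 0" if "norm x \<ge> R" for x
    using that by (force simp: subset_eq)
  have contg: "continuous_on UNIV g"
    using der has_derivative_continuous continuous_at_imp_continuous_on by blast
  define s where "s k = inverse (real (Suc k))" for k
  have s0: "s k > 0" and s1: "s k \<le> 1" for k
    by (auto simp: s_def field_simps)
  have s_lim: "s \<longlonglongrightarrow> 0"
    unfolding s_def by (rule LIMSEQ_inverse_real_of_nat)
  define d where "d k x = (g (x + s k *\<^sub>R i) - g x) / s k" for k x
  have g_int: "integrable lborel g"
  proof -
    have "bounded (g ` cball 0 R)"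
      by (intro compact_imp_bounded compact_continuous_image continuous_on_subset[OF contg]) auto
    then obtain M where "\<forall>x\<in>cball 0 R. norm (g x) \<le> M"
      unfolding bounded_iff by auto
    then show ?thesis
      using contg zero
      by (intro integrableI_bounded_set[where A = "cball 0 R" and B = M])
         (auto simp: borel_measurable_continuous_onI emeasure_bounded_finite[unfolded infinity_ennreal_def])
  qed
  have shift: "integrable lborel (\<lambda>x. g (x + c))" "integral\<^sup>L lborel (\<lambda>x. g (x + c)) = integral\<^sup>L lborel g" for c
  proof -
    have meas: "g \<in> borel_measurable borel"
      using contg by (simp add: borel_measurable_continuous_onI)
    have *: "integrable (distr lborel borel ((+) c)) g"
      by (subst lborel_distr_plus) (rule g_int)
    then have "integrable lborel (\<lambda>x. g (c + x))"
      by (subst (asm) integrable_distr_eq) (use meas in auto)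
    then show "integrable lborel (\<lambda>x. g (x + c))" by (simp add: add.commute)
    have "integral\<^sup>L lborel g = integral\<^sup>L (distr lborel borel ((+) c)) g"
      by (subst lborel_distr_plus) (rule refl)
    also have "\<dots> = integral\<^sup>L lborel (\<lambda>x. g (c + x))"
      by (rule integral_distr) (use meas in auto)
    finally show "integral\<^sup>L lborel (\<lambda>x. g (x + c)) = integral\<^sup>L lborel g"
      by (simp add: add.commute)
  qed
  have d_int: "(d k has_integral 0) UNIV" for k
  proof -
    have "integrable lborel (d k)"
      unfolding d_def by (intro integrable_divide_zero Bochner_Integration.integrable_diff shift g_int)
    from has_integral_integral_lborel[OF this] show ?thesis
      unfolding d_def by (simp add: shift g_int)
  qed
  have d_bound: "\<bar>d k x\<bar> \<le> B" for k x
  proof -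
    have "((\<lambda>t. g (x + t *\<^sub>R i)) has_derivative (\<lambda>t. g' (x + y *\<^sub>R i) (t *\<^sub>R i))) (at y within {0..s k})" for y
      by (rule has_derivative_compose[OF _ der]) (auto intro!: derivative_eq_intros)
    then have "\<exists>y\<in>{0<..<s k}. g (x + s k *\<^sub>R i) - g (x + 0 *\<^sub>R i) = (\<lambda>t. g' (x + y *\<^sub>R i) (t *\<^sub>R i)) (s k - 0)"
      by (intro mvt_simple[OF s0]) auto
    then obtain y where y: "g (x + s k *\<^sub>R i) - g x = g' (x + y *\<^sub>R i) (s k *\<^sub>R i)" by auto
    have "linear (g' (x + y *\<^sub>R i))"
      using der has_derivative_linear by blast
    then have "d k x = g' (x + y *\<^sub>R i) i"
      using s0[of k] y unfolding d_def by (simp add: linear_scale)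
    then show ?thesis using bnd by simp
  qed
  \<comment> \<open>The steps satisfy \<open>s k \<le> 1\<close>, so enlarging the radius by
    \<open>norm i\<close> makes both evaluation points lie outside the support.\<close>
  have d_supp: "d k x = 0" if "norm x \<ge> R + norm i" for k x
  proof -
    have "norm x \<le> norm (x + s k *\<^sub>R i) + s k * norm i"
      using norm_triangle_ineq4[of "x + s k *\<^sub>R i" "s k *\<^sub>R i"] s0[of k] by simp
    moreover have "s k * norm i \<le> norm i"
      using s1[of k] by (simp add: mult_left_le_one_le s0 less_imp_le)
    ultimately have "g (x + s k *\<^sub>R i) = 0" "g x = 0"
      using that by (auto intro!: zero intro: order_trans[OF _ that])
    then show ?thesis by (simp add: d_def)
  qed
  have h_int: "(\<lambda>x. indicator (cball 0 (R + norm i)) x *\<^sub>R \<bar>B\<bar> :: real) integrable_on (UNIV :: 'a set)"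
    by (intro integrable_on_lborel integrable_real_indicator[THEN integrable_scaleR_left])
       (auto simp: emeasure_lborel_cball_finite[unfolded infinity_ennreal_def])
  show ?thesis
  proof (rule has_integral_dominated_convergence[OF d_int h_int])
    show "\<forall>x\<in>UNIV. norm (d k x) \<le> indicator (cball 0 (R + norm i)) x *\<^sub>R \<bar>B\<bar>" for k
    proof
      fix x
      show "norm (d k x) \<le> indicator (cball 0 (R + norm i)) x *\<^sub>R \<bar>B\<bar>"
        using d_bound[of k x] d_supp[of x k] by (cases "x \<in> cball 0 (R + norm i)") auto
    qed
    show "\<forall>x\<in>UNIV. (\<lambda>k. d k x) \<longlonglongrightarrow> g' x i"
    proof
      fix x
      have lin: "linear (g' x)"
        using der has_derivative_linear by blast
      have "((\<lambda>t. g (x + t *\<^sub>R i)) has_derivative (\<lambda>t. g' x (t *\<^sub>R i))) (at 0)"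
        by (rule has_derivative_compose[of "\<lambda>t. x + t *\<^sub>R i" _ 0 UNIV g "g' x"])
           (use der[of x] in \<open>auto intro!: derivative_eq_intros\<close>)
      then have "((\<lambda>t. g (x + t *\<^sub>R i)) has_field_derivative g' x i) (at 0)"
        unfolding has_field_derivative_def
        by (simp add: linear_scale[OF lin] mult_commute_abs)
      then have "((\<lambda>t. (g (x + t *\<^sub>R i) - g x) / t) \<longlongrightarrow> g' x i) (at 0)"
        by (simp add: DERIV_def)
      then show "(\<lambda>k. d k x) \<longlonglongrightarrow> g' x i"
        unfolding d_def
        by (rule filterlim_compose) (use s_lim s0 in \<open>auto simp: filterlim_at less_imp_neq[symmetric]\<close>)
    qed
    show "(\<lambda>k. 0) \<longlonglongrightarrow> (0::real)" by simp
  qed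
qed

text \<open>The exponent is at least 2, so the power of the positive part is continuously
  differentiable across 0: there the difference quotient is at most
  \<open>\<bar>h\<bar> ^ (n + 1)\<close>. Both the cutoff and the test function of the comparison
  are built from it.\<close>

lemma has_real_derivative_max_0_power:
  "((\<lambda>t::real. max 0 t ^ (n + 2)) has_real_derivative real (n + 2) * max 0 t ^ (n + 1)) (at t)"
proof -
  consider "t > 0" | "t < 0" | "t = 0" by linarith
  then show ?thesis
  proof cases
    case 1
    have "((\<lambda>t. t ^ (n + 2)) has_real_derivative real (n + 2) * t ^ (n + 1)) (at t)"
      by (rule DERIV_cong[OF DERIV_pow]) simp
    moreover have "eventually (\<lambda>s. s ^ (n + 2) = max 0 s ^ (n + 2)) (nhds t)"
      using eventually_nhds_in_open[of "{0<..}" t] 1 by (auto elim!: eventually_mono)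
    ultimately show ?thesis
      using 1 DERIV_cong_ev[of t t "\<lambda>t. t ^ (n + 2)" "\<lambda>t. max 0 t ^ (n + 2)"
        "real (n + 2) * t ^ (n + 1)" "real (n + 2) * t ^ (n + 1)"] by simp
  next
    case 2
    have "((\<lambda>t::real. 0) has_real_derivative 0) (at t)" by simp
    moreover have "eventually (\<lambda>s. 0 = max 0 s ^ (n + 2)) (nhds t)"
      using eventually_nhds_in_open[of "{..<0}" t] 2 by (auto elim!: eventually_mono)
    ultimately show ?thesis
      using 2 DERIV_cong_ev[of t t "\<lambda>_. 0" "\<lambda>t. max 0 t ^ (n + 2)" 0 0] by simp
  next
    case 3
    have "((\<lambda>h::real. max 0 h ^ (n + 2) / h) \<longlongrightarrow> 0) (at 0)"
    proof (rule Lim_null_comparison)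
      have "norm (max 0 h ^ (n + 2) / h) \<le> \<bar>h\<bar> ^ (n + 1)" for h :: real
        by (cases "h \<ge> 0") (simp_all add: max_def mult_nonpos_nonneg)
      then show "\<forall>\<^sub>F h::real in at 0. norm (max 0 h ^ (n + 2) / h) \<le> \<bar>h\<bar> ^ (n + 1)"
        by simp
      show "((\<lambda>h::real. \<bar>h\<bar> ^ (n + 1)) \<longlongrightarrow> 0) (at 0)"
        by (auto intro!: tendsto_eq_intros)
    qed
    then show ?thesis using 3 by (simp add: DERIV_def)
  qed
qed

text \<open>On the frontier \<open>G\<close> is the continuous extension of the interior gradient;
  the boundary conditions are read off from these values.\<close>

definition has_grad :: "'a::euclidean_space set \<Rightarrow> ('a \<Rightarrow> real) \<Rightarrow> ('a \<Rightarrow> 'a) \<Rightarrow> bool" where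
  "has_grad \<Omega> g G \<longleftrightarrow> continuous_on (closure \<Omega>) g \<and> continuous_on (closure \<Omega>) G \<and>
     (\<forall>x\<in>\<Omega>. (g has_derivative (\<lambda>h. G x \<bullet> h)) (at x))"

text \<open>The derivative need not be bounded or continuous; bounded diagonal entries suffice for
  dominated convergence of the difference quotients.\<close>
definition has_div :: "'a::euclidean_space set \<Rightarrow> ('a \<Rightarrow> 'a) \<Rightarrow> ('a \<Rightarrow> real) \<Rightarrow> bool" where
  "has_div \<Omega> X f \<longleftrightarrow> continuous_on (closure \<Omega>) X \<and>
     (\<exists>X' B. \<forall>x\<in>\<Omega>. (X has_derivative X' x) (at x) \<and> f x = (\<Sum>i\<in>Basis. X' x i \<bullet> i) \<and>
        (\<forall>i\<in>Basis. \<bar>X' x i \<bullet> i\<bar> \<le> B))"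

lemma has_divI:
  assumes "continuous_on (closure \<Omega>) X"
    and "\<And>x. x \<in> \<Omega> \<Longrightarrow> (X has_derivative X' x) (at x)"
    and "\<And>x. x \<in> \<Omega> \<Longrightarrow> f x = (\<Sum>i\<in>Basis. X' x i \<bullet> i)"
    and "\<And>x i. x \<in> \<Omega> \<Longrightarrow> i \<in> Basis \<Longrightarrow> \<bar>X' x i \<bullet> i\<bar> \<le> B"
  shows "has_div \<Omega> X f"
  using assms(1) unfolding has_div_def
  by (intro conjI exI[of _ X'] exI[of _ B] ballI) (use assms in blast)+

lemma has_divE:
  assumes "has_div \<Omega> X f"
  obtains X' B where "continuous_on (closure \<Omega>) X"
    and "\<And>x. x \<in> \<Omega> \<Longrightarrow> (X has_derivative X' x) (at x)"
    and "\<And>x. x \<in> \<Omega> \<Longrightarrow> f x = (\<Sum>i\<in>Basis. X' x i \<bullet> i)"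
    and "\<And>x i. x \<in> \<Omega> \<Longrightarrow> i \<in> Basis \<Longrightarrow> \<bar>X' x i \<bullet> i\<bar> \<le> B"
  using assms unfolding has_div_def by blast

lemma bounded_on_closure:
  fixes f :: "'a::euclidean_space \<Rightarrow> 'b::real_normed_vector"
  assumes "bounded \<Omega>" and "continuous_on (closure \<Omega>) f"
  obtains M where "\<And>x. x \<in> closure \<Omega> \<Longrightarrow> norm (f x) \<le> M"
proof -
  have "bounded (f ` closure \<Omega>)"
    using assms by (intro compact_imp_bounded compact_continuous_image) auto
  then show ?thesis
    using that unfolding bounded_iff by auto
qed

lemma continuous_on_closure_integrable:
  fixes f :: "'a::euclidean_space \<Rightarrow> real"
  assumes "open \<Omega>" and "bounded \<Omega>" and f: "continuous_on (closure \<Omega>) f"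
  shows "f integrable_on \<Omega>"
proof -
  obtain M where M: "\<And>x. x \<in> closure \<Omega> \<Longrightarrow> norm (f x) \<le> M"
    using bounded_on_closure[OF assms(2) f] by blast
  have lm: "\<Omega> \<in> lmeasurable"
    using assms by (simp add: lmeasurable_open)
  have "continuous_on \<Omega> f"
    using f closure_subset continuous_on_subset by blast
  then have "f absolutely_integrable_on \<Omega>"
    using lm M closure_subset[of \<Omega>] integrable_on_const[OF lm, of M]
    by (intro measurable_bounded_by_integrable_imp_absolutely_integrable[where g = "\<lambda>_. M"]
        continuous_imp_measurable_on_sets_lebesgue) auto
  then show ?thesis
    by (rule set_lebesgue_integral_eq_integral)
qed

text \<open>The set \<open>S\<close> restricts the chain rule to a set containing the range of
  \<open>g\<close>, which admits powers that are differentiable only on a half-line.\<close>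

lemma has_grad_compose:
  assumes g: "has_grad \<Omega> g G"
    and "continuous_on S \<phi>" and "continuous_on S \<phi>'" and S: "g ` closure \<Omega> \<subseteq> S"
    and der: "\<And>t. t \<in> S \<Longrightarrow> (\<phi> has_real_derivative \<phi>' t) (at t)"
  shows "has_grad \<Omega> (\<lambda>x. \<phi> (g x)) (\<lambda>x. \<phi>' (g x) *\<^sub>R G x)"
  unfolding has_grad_def
proof (intro conjI ballI)
  show "continuous_on (closure \<Omega>) (\<lambda>x. \<phi> (g x))"
    using g S by (auto simp: has_grad_def intro: continuous_on_compose2[OF assms(2)])
  show "continuous_on (closure \<Omega>) (\<lambda>x. \<phi>' (g x) *\<^sub>R G x)"
    using g S by (auto simp: has_grad_def intro!: continuous_intros intro: continuous_on_compose2[OF assms(3)])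
  fix x assume x: "x \<in> \<Omega>"
  then have "g x \<in> S"
    using S closure_subset by blast
  then have "(\<phi> has_derivative (\<lambda>s. \<phi>' (g x) * s)) (at (g x))"
    using der by (simp add: has_field_derivative_def)
  with g x show "((\<lambda>x. \<phi> (g x)) has_derivative (\<lambda>h. (\<phi>' (g x) *\<^sub>R G x) \<bullet> h)) (at x)"
    using has_derivative_compose[of g "\<lambda>h. G x \<bullet> h" x UNIV \<phi>]
    by (auto simp: has_grad_def)
qed

lemma has_grad_const: "has_grad \<Omega> (\<lambda>_. c) (\<lambda>_. 0)"
  by (simp add: has_grad_def)

lemma has_grad_diff:
  assumes "has_grad \<Omega> f F" and "has_grad \<Omega> g G"
  shows "has_grad \<Omega> (\<lambda>x. f x - g x) (\<lambda>x. F x - G x)"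
  using assms unfolding has_grad_def
  by (auto intro!: continuous_intros derivative_eq_intros simp: inner_diff_left)

lemma has_div_cong:
  assumes "has_div \<Omega> X f" and "\<And>x. x \<in> \<Omega> \<Longrightarrow> f x = g x"
  shows "has_div \<Omega> X g"
  using assms unfolding has_div_def by auto

lemma has_div_add:
  assumes "has_div \<Omega> X f" and "has_div \<Omega> Y g"
  shows "has_div \<Omega> (\<lambda>x. X x + Y x) (\<lambda>x. f x + g x)"
proof -
  obtain X' B where X: "continuous_on (closure \<Omega>) X"
    "\<And>x. x \<in> \<Omega> \<Longrightarrow> (X has_derivative X' x) (at x)"
    "\<And>x. x \<in> \<Omega> \<Longrightarrow> f x = (\<Sum>i\<in>Basis. X' x i \<bullet> i)"
    "\<And>x i. x \<in> \<Omega> \<Longrightarrow> i \<in> Basis \<Longrightarrow> \<bar>X' x i \<bullet> i\<bar> \<le> B"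
    using assms(1) by (rule has_divE) (rule that; blast)
  obtain Y' C where Y: "continuous_on (closure \<Omega>) Y"
    "\<And>x. x \<in> \<Omega> \<Longrightarrow> (Y has_derivative Y' x) (at x)"
    "\<And>x. x \<in> \<Omega> \<Longrightarrow> g x = (\<Sum>i\<in>Basis. Y' x i \<bullet> i)"
    "\<And>x i. x \<in> \<Omega> \<Longrightarrow> i \<in> Basis \<Longrightarrow> \<bar>Y' x i \<bullet> i\<bar> \<le> C"
    using assms(2) by (rule has_divE) (rule that; blast)
  show ?thesis
  proof (rule has_divI[where X' = "\<lambda>x h. X' x h + Y' x h" and B = "B + C"])
    show "continuous_on (closure \<Omega>) (\<lambda>x. X x + Y x)"
      using X(1) Y(1) by (rule continuous_on_add)
    fix x assume x: "x \<in> \<Omega>"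
    show "((\<lambda>x. X x + Y x) has_derivative (\<lambda>h. X' x h + Y' x h)) (at x)"
      using X(2)[OF x] Y(2)[OF x] by (rule has_derivative_add)
    show "f x + g x = (\<Sum>i\<in>Basis. (X' x i + Y' x i) \<bullet> i)"
      using X(3)[OF x] Y(3)[OF x] by (simp add: inner_add_left sum.distrib)
    fix i :: 'a assume i: "i \<in> Basis"
    show "\<bar>(X' x i + Y' x i) \<bullet> i\<bar> \<le> B + C"
      using X(4)[OF x i] Y(4)[OF x i] by (simp add: inner_add_left abs_le_iff)
  qed
qed

text \<open>This is the product rule for the divergence. The diagonal entries of the new derivative
  stay bounded because \<open>g\<close>, \<open>G\<close> and \<open>X\<close> are continuous on a
  compact closure.\<close>

lemma has_div_scaleR:
  assumes "bounded \<Omega>" and g: "has_grad \<Omega> g G" and "has_div \<Omega> X f"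
  shows "has_div \<Omega> (\<lambda>x. g x *\<^sub>R X x) (\<lambda>x. g x * f x + G x \<bullet> X x)"
proof -
  obtain X' B where contX: "continuous_on (closure \<Omega>) X" and X: "\<And>x. x \<in> \<Omega> \<Longrightarrow> (X has_derivative X' x) (at x)"
    "\<And>x. x \<in> \<Omega> \<Longrightarrow> f x = (\<Sum>i\<in>Basis. X' x i \<bullet> i)"
    "\<And>x i. x \<in> \<Omega> \<Longrightarrow> i \<in> Basis \<Longrightarrow> \<bar>X' x i \<bullet> i\<bar> \<le> B"
    using assms(3) by (rule has_divE) (rule that; blast)
  have cont: "continuous_on (closure \<Omega>) g" "continuous_on (closure \<Omega>) G" "continuous_on (closure \<Omega>) X"
    using assms unfolding has_div_def has_grad_def by auto
  obtain Mg where Mg: "\<And>x. x \<in> closure \<Omega> \<Longrightarrow> norm (g x) \<le> Mg"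
    using bounded_on_closure[OF assms(1) cont(1)] by blast
  obtain MG where MG: "\<And>x. x \<in> closure \<Omega> \<Longrightarrow> norm (G x) \<le> MG"
    using bounded_on_closure[OF assms(1) cont(2)] by blast
  obtain MX where MX: "\<And>x. x \<in> closure \<Omega> \<Longrightarrow> norm (X x) \<le> MX"
    using bounded_on_closure[OF assms(1) cont(3)] by blast
  let ?F = "\<lambda>x h. g x *\<^sub>R X' x h + (G x \<bullet> h) *\<^sub>R X x"
  show ?thesis
  proof (rule has_divI[where X' = ?F and B = "Mg * B + MG * MX"])
    show "continuous_on (closure \<Omega>) (\<lambda>x. g x *\<^sub>R X x)"
      using cont by (intro continuous_intros)
    fix x assume x: "x \<in> \<Omega>"
    then have xc: "x \<in> closure \<Omega>" using closure_subset by blast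
    have "(g has_derivative (\<lambda>h. G x \<bullet> h)) (at x)"
      using g x unfolding has_grad_def by blast
    then show "((\<lambda>x. g x *\<^sub>R X x) has_derivative ?F x) (at x)"
      using X(1)[OF x] by (rule has_derivative_scaleR)
    have "G x \<bullet> X x = (\<Sum>i\<in>Basis. (G x \<bullet> i) * (X x \<bullet> i))"
      by (rule euclidean_inner)
    then show "g x * f x + G x \<bullet> X x = (\<Sum>i\<in>Basis. ?F x i \<bullet> i)"
      by (simp add: X(2)[OF x] inner_add_left sum.distrib sum_distrib_left)
    fix i :: 'a assume i: "i \<in> Basis"
    have "\<bar>g x * (X' x i \<bullet> i)\<bar> \<le> Mg * B"
      using X(3)[OF x i] Mg[OF xc] unfolding abs_mult
      by (intro mult_mono) (auto intro: order_trans[OF abs_ge_zero])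
    moreover have "\<bar>(G x \<bullet> i) * (X x \<bullet> i)\<bar> \<le> MG * MX"
      using Basis_le_norm[OF i, of "G x"] Basis_le_norm[OF i, of "X x"] MG[OF xc] MX[OF xc]
      unfolding abs_mult by (intro mult_mono) (auto intro: order_trans[OF norm_ge_zero])
    ultimately show "\<bar>?F x i \<bullet> i\<bar> \<le> Mg * B + MG * MX"
      by (simp add: inner_add_left)
  qed
qed

text \<open>The extension of \<open>X\<close> by zero is differentiable on the whole space: a point
  outside \<open>\<Omega>\<close> has the complement of \<open>K\<close> as a neighbourhood on which
  the extension vanishes. Each diagonal derivative then has integral zero.\<close>

lemma integral_div_eq_0:
  assumes "open \<Omega>" and "bounded \<Omega>" and div: "has_div \<Omega> X f"
    and "closed K" and "K \<subseteq> \<Omega>" and van: "\<And>x. x \<in> \<Omega> - K \<Longrightarrow> X x = 0"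
  shows "(f has_integral 0) \<Omega>"
proof -
  obtain X' B where contX: "continuous_on (closure \<Omega>) X" and X: "\<And>x. x \<in> \<Omega> \<Longrightarrow> (X has_derivative X' x) (at x)"
    "\<And>x. x \<in> \<Omega> \<Longrightarrow> f x = (\<Sum>i\<in>Basis. X' x i \<bullet> i)"
    "\<And>x i. x \<in> \<Omega> \<Longrightarrow> i \<in> Basis \<Longrightarrow> \<bar>X' x i \<bullet> i\<bar> \<le> B"
    using div by (rule has_divE) (rule that; blast)
  define Y where "Y x = (if x \<in> \<Omega> then X x else 0)" for x
  define Y' where "Y' x h = (if x \<in> \<Omega> then X' x h else 0)" for x h
  have der: "(Y has_derivative Y' x) (at x)" for x
  proof (cases "x \<in> \<Omega>")
    case True
    have "eventually (\<lambda>y. X y = Y y) (at x)"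
      using eventually_at_topological \<open>open \<Omega>\<close> True by (fastforce simp: Y_def)
    then show ?thesis
      using X(1)[OF True] True has_derivative_transform_eventually[of X "X' x" x UNIV Y]
      by (simp add: Y_def Y'_def[abs_def])
  next
    case False
    have "eventually (\<lambda>y. 0 = Y y) (at x)"
      unfolding eventually_at_topological using \<open>closed K\<close> \<open>K \<subseteq> \<Omega>\<close> False van
      by (intro exI[of _ "-K"]) (auto simp: Y_def)
    then show ?thesis
      using False has_derivative_transform_eventually[of "\<lambda>_. 0" "\<lambda>_. 0" x UNIV Y]
      by (simp add: Y_def Y'_def[abs_def])
  qed
  have "((\<lambda>x. Y' x i \<bullet> i) has_integral 0) UNIV" if i: "i \<in> Basis" for i
  proof (rule integral_directional_derivative_eq_0[where g = "\<lambda>x. Y x \<bullet> i" and g' = "\<lambda>x h. Y' x h \<bullet> i" and B = "\<bar>B\<bar>"])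
    show "((\<lambda>x. Y x \<bullet> i) has_derivative (\<lambda>h. Y' x h \<bullet> i)) (at x)" for x
      by (intro has_derivative_inner_left der)
    show "bounded {x. Y x \<bullet> i \<noteq> 0}"
      using \<open>bounded \<Omega>\<close> by (rule bounded_subset) (auto simp: Y_def split: if_splits)
    show "\<bar>Y' x i \<bullet> i\<bar> \<le> \<bar>B\<bar>" for x
      using X(3)[of x i] i by (auto simp: Y'_def)
  qed
  then have "((\<lambda>x. \<Sum>i\<in>Basis. Y' x i \<bullet> i) has_integral (\<Sum>i\<in>(Basis::'a set). 0)) UNIV"
    by (intro has_integral_sum) auto
  then have "((\<lambda>x. if x \<in> \<Omega> then f x else 0) has_integral 0) UNIV"
    by (rule has_integral_eq[rotated, THEN has_integral_eq_rhs]) (auto simp: Y'_def X(2))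
  then show ?thesis
    by (simp add: has_integral_restrict_UNIV)
qed

section \<open>Smooth defining functions and their gradient fields\<close>

lemma smooth_fun_partial:
  assumes "smooth_fun f" and "i \<in> Basis"
  shows "smooth_fun (\<lambda>x. frechet_derivative f (at x) i)"
proof -
  have "higher_partial f (\<lambda>x. frechet_derivative f (at x) i)"
    using assms(1) unfolding smooth_fun_def
    by (intro higher_partial.step[OF higher_partial.base assms(2)])
       (use higher_partial.base frechet_derivative_works in blast)
  moreover have "higher_partial h g \<Longrightarrow> higher_partial f h \<Longrightarrow> higher_partial f g" for h g
    by (induction rule: higher_partial.induct) (auto intro: higher_partial.step)
  ultimately show ?thesis
    using assms(1) unfolding smooth_fun_def by blast
qed

lemma smooth_fun_has_derivative:
  "smooth_fun f \<Longrightarrow> (f has_derivative frechet_derivative f (at x)) (at x)"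
  unfolding smooth_fun_def using higher_partial.base frechet_derivative_works by blast

lemma smooth_fun_continuous_on: "smooth_fun f \<Longrightarrow> continuous_on S f"
  by (meson smooth_fun_has_derivative has_derivative_continuous continuous_at_imp_continuous_at_within
      continuous_on_eq_continuous_within)

lemma smooth_domain_frontier:
  assumes "smooth_domain \<Omega> \<rho>" and x: "x \<in> frontier \<Omega>"
  shows "\<rho> x = 0"
proof -
  have \<Omega>: "\<Omega> = {x. \<rho> x < 0}" and sm: "smooth_fun \<rho>" and op: "open \<Omega>"
    using assms unfolding smooth_domain_def by auto
  have "closed {x. \<rho> x \<le> 0}"
    using smooth_fun_continuous_on[OF sm, of UNIV] by (intro closed_Collect_le) auto
  then have "closure \<Omega> \<subseteq> {x. \<rho> x \<le> 0}"
    using \<Omega> by (intro closure_minimal) auto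
  then show ?thesis
    using x \<Omega> op by (auto simp: frontier_def interior_open)
qed

lemma smooth_fun_has_grad:
  assumes "smooth_fun f"
  shows "has_grad \<Omega> f (grad f)"
  unfolding has_grad_def
proof (intro conjI ballI)
  show "continuous_on (closure \<Omega>) (grad f)"
    unfolding grad_def[abs_def]
    by (intro continuous_intros smooth_fun_continuous_on smooth_fun_partial assms)
  fix x
  have "frechet_derivative f (at x) = (\<lambda>h. grad f x \<bullet> h)"
  proof
    fix h
    have lin: "linear (frechet_derivative f (at x))"
      using assms smooth_fun_has_derivative has_derivative_linear by blast
    have "frechet_derivative f (at x) h = frechet_derivative f (at x) (\<Sum>i\<in>Basis. (h \<bullet> i) *\<^sub>R i)"
      by (simp add: euclidean_representation)
    also have "\<dots> = grad f x \<bullet> h"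
      by (simp add: linear_sum[OF lin] linear_scale[OF lin] grad_def inner_sum_right inner_commute[of _ h] mult.commute)
    finally show "frechet_derivative f (at x) h = grad f x \<bullet> h" .
  qed
  then show "(f has_derivative (\<lambda>h. grad f x \<bullet> h)) (at x)"
    using smooth_fun_has_derivative[OF assms, of x] by simp
qed (rule smooth_fun_continuous_on[OF assms])

text \<open>Here \<open>l\<close> is the Laplacian of \<open>f\<close>. For the defining function,
  the field provides the perturbation that turns a nonnegative boundary flux into a strictly
  positive one.\<close>

lemma smooth_fun_has_div_grad:
  assumes f: "smooth_fun f" and "bounded \<Omega>"
  obtains l where "has_div \<Omega> (grad f) l" and "continuous_on (closure \<Omega>) l"
proof -
  let ?p = "\<lambda>i x. frechet_derivative f (at x) i"
  let ?H = "\<lambda>x h. \<Sum>j\<in>Basis. frechet_derivative (?p j) (at x) h *\<^sub>R j"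
  let ?l = "\<lambda>x. \<Sum>i\<in>Basis. frechet_derivative (?p i) (at x) i"
  have der: "(grad f has_derivative ?H x) (at x)" for x
    unfolding grad_def[abs_def]
    by (intro has_derivative_sum has_derivative_scaleR_left smooth_fun_has_derivative smooth_fun_partial f)
  have H: "?H x i \<bullet> i = frechet_derivative (?p i) (at x) i" if "i \<in> Basis" for i x
    using that by (simp add: inner_sum_left inner_Basis if_distrib cong: if_cong)
  have cont: "continuous_on (closure \<Omega>) (\<lambda>x. frechet_derivative (?p i) (at x) i)" if "i \<in> Basis" for i
    using that f by (intro smooth_fun_continuous_on smooth_fun_partial)
  have "\<forall>i\<in>Basis. \<exists>M. \<forall>x\<in>closure \<Omega>. norm (frechet_derivative (?p i) (at x) i) \<le> M"
    using bounded_on_closure[OF \<open>bounded \<Omega>\<close> cont] by metis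
  then obtain M where M: "\<And>i x. i \<in> Basis \<Longrightarrow> x \<in> closure \<Omega> \<Longrightarrow> norm (frechet_derivative (?p i) (at x) i) \<le> M i"
    by metis
  have "\<bar>?H x i \<bullet> i\<bar> \<le> (\<Sum>j\<in>Basis. \<bar>M j\<bar>)" if "x \<in> \<Omega>" "i \<in> Basis" for x i
  proof -
    have "\<bar>?H x i \<bullet> i\<bar> \<le> \<bar>M i\<bar>"
      using M[of i x] that closure_subset[of \<Omega>] H[of i x] by force
    also have "\<dots> \<le> (\<Sum>j\<in>Basis. \<bar>M j\<bar>)"
      using that by (intro member_le_sum) auto
    finally show ?thesis .
  qed
  moreover have "continuous_on (closure \<Omega>) (grad f)"
    using smooth_fun_has_grad[OF f, of \<Omega>] unfolding has_grad_def by blast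
  moreover have "?l x = (\<Sum>i\<in>Basis. ?H x i \<bullet> i)" for x
    by (intro sum.cong refl H[symmetric])
  ultimately have "has_div \<Omega> (grad f) ?l"
    using der by (intro has_divI[where X' = ?H])
  moreover have "continuous_on (closure \<Omega>) ?l"
    by (intro continuous_on_sum cont)
  ultimately show ?thesis using that by blast
qed

section \<open>Nonnegative flux through the boundary\<close>

text \<open>With \<open>t = - \<rho> / \<delta> - 1\<close> the first factor is half the derivative
  of the cutoff and \<open>(t + 1)\<^sup>2\<close> is
  \<open>\<rho>\<^sup>2 / \<delta>\<^sup>2\<close>. For \<open>t > 0\<close> the claim reduces to a
  quartic polynomial that is written as a sum of squares.\<close>

lemma cutoff_estimate: "max 0 t / (1 + (max 0 t)\<^sup>2)\<^sup>2 * (t + 1)\<^sup>2 \<le> (1::real)"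
proof (cases "t > 0")
  case True
  have "t * (t + 1)\<^sup>2 \<le> (1 + t\<^sup>2) * (1 + t\<^sup>2)"
  proof -
    have "(1 + t\<^sup>2) * (1 + t\<^sup>2) - t * (t + 1)\<^sup>2 = (t\<^sup>2 - t / 2 - 1 / 2)\<^sup>2 + (3 / 4 * t\<^sup>2 - 3 / 2 * t + 3 / 4)"
      by (simp add: power2_eq_square algebra_simps)
    moreover have "3 / 4 * t\<^sup>2 - 3 / 2 * t + 3 / 4 = 3 / 4 * (t - 1)\<^sup>2"
      by (simp add: power2_eq_square algebra_simps)
    ultimately show ?thesis
      using zero_le_power2[of "t\<^sup>2 - t / 2 - 1 / 2"] zero_le_power2[of "t - 1"] by linarith
  qed
  moreover have "1 + t\<^sup>2 > 0"
    using zero_le_power2[of t] by linarith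
  ultimately show ?thesis
    using True by (simp add: power2_eq_square[of "1 + t\<^sup>2"] divide_le_eq)
qed simp

text \<open>Strict positivity on the boundary and compactness give \<open>F \<bullet> \<nabla>\<rho> \<ge> - K \<rho>\<^sup>2\<close>. For the cutoff
  \<open>\<psi> (- \<rho> / \<delta> - 1)\<close>, whose gradient is \<open>O(1 / \<delta>)\<close>, the factor \<open>\<rho>\<^sup>2\<close> then leaves an error \<open>O(\<delta>)\<close>, so no
  volume estimate for boundary layers is needed.\<close>
lemma flux_nonneg_strict:
  assumes dom: "smooth_domain \<Omega> \<rho>"
    and F: "has_div \<Omega> F f" and f: "continuous_on (closure \<Omega>) f"
    and bd: "\<And>x. x \<in> frontier \<Omega> \<Longrightarrow> 0 < F x \<bullet> grad \<rho> x"
  shows "0 \<le> integral \<Omega> f"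
proof -
  have op: "open \<Omega>" and bdd: "bounded \<Omega>" and sm: "smooth_fun \<rho>" and \<Omega>: "\<Omega> = {x. \<rho> x < 0}"
    using dom unfolding smooth_domain_def by auto
  have \<rho>_grad: "has_grad \<Omega> \<rho> (grad \<rho>)"
    using sm by (rule smooth_fun_has_grad)
  have contF: "continuous_on (closure \<Omega>) F" and cont\<rho>: "continuous_on UNIV \<rho>"
    and contG: "continuous_on (closure \<Omega>) (grad \<rho>)"
    using F \<rho>_grad smooth_fun_continuous_on[OF sm] unfolding has_div_def has_grad_def by blast+
  have contFG: "continuous_on (closure \<Omega>) (\<lambda>x. F x \<bullet> grad \<rho> x)"
    using contF contG by (rule continuous_on_inner)
  obtain K where K: "K \<ge> 0" "\<And>x. x \<in> closure \<Omega> \<Longrightarrow> F x \<bullet> grad \<rho> x \<ge> - K * (\<rho> x)\<^sup>2"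
  proof -
    \<comment> \<open>The set where the flux density has the wrong sign is compact and, by strict
      positivity on the frontier, contained in \<open>\<Omega>\<close>. Hence \<open>\<rho>\<close>
      has no zero on it and the quotient by \<open>\<rho>\<^sup>2\<close> is bounded there.\<close>
    define S where "S = {x \<in> closure \<Omega>. F x \<bullet> grad \<rho> x \<le> 0}"
    have "closed S"
      unfolding S_def using contFG by (intro continuous_on_closed_Collect_le continuous_on_const closed_closure)
    moreover have "bounded S"
      using bounded_closure[OF bdd] by (rule bounded_subset) (auto simp: S_def)
    ultimately have "compact S"
      by (simp add: compact_eq_bounded_closed)
    have neg: "\<rho> x < 0" if "x \<in> S" for x
    proof -
      have "x \<in> closure \<Omega>" "x \<notin> frontier \<Omega>"
        using that bd[of x] unfolding S_def by fastforce+
      then have "x \<in> \<Omega>"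
        unfolding frontier_def interior_open[OF op] by blast
      then show ?thesis
        using \<Omega> by blast
    qed
    have "continuous_on S (\<lambda>x. F x \<bullet> grad \<rho> x / (\<rho> x)\<^sup>2)"
    proof (intro continuous_on_divide continuous_on_power ballI)
      show "continuous_on S (\<lambda>x. F x \<bullet> grad \<rho> x)"
        using contFG by (rule continuous_on_subset) (auto simp: S_def)
      show "continuous_on S \<rho>"
        using cont\<rho> by (rule continuous_on_subset) simp
      show "(\<rho> x)\<^sup>2 \<noteq> 0" if "x \<in> S" for x
        using neg[OF that] by simp
    qed
    then have "bounded ((\<lambda>x. F x \<bullet> grad \<rho> x / (\<rho> x)\<^sup>2) ` S)"
      using \<open>compact S\<close> by (intro compact_imp_bounded compact_continuous_image)
    then obtain M where M: "\<And>x. x \<in> S \<Longrightarrow> \<bar>F x \<bullet> grad \<rho> x / (\<rho> x)\<^sup>2\<bar> \<le> M"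
      unfolding bounded_iff by auto
    have "F x \<bullet> grad \<rho> x \<ge> - \<bar>M\<bar> * (\<rho> x)\<^sup>2" if x: "x \<in> closure \<Omega>" for x
    proof (cases "x \<in> S")
      case True
      then have "- \<bar>M\<bar> \<le> F x \<bullet> grad \<rho> x / (\<rho> x)\<^sup>2"
        using M[of x] by linarith
      moreover have "(\<rho> x)\<^sup>2 > 0" using neg[OF True] by simp
      ultimately show ?thesis by (simp add: pos_le_divide_eq)
    next
      case False
      then have "0 \<le> F x \<bullet> grad \<rho> x" using x by (auto simp: S_def)
      moreover have "- \<bar>M\<bar> * (\<rho> x)\<^sup>2 \<le> 0" by simp
      ultimately show ?thesis by linarith
    qed
    then show ?thesis by (intro that[of "\<bar>M\<bar>"]) auto
  qed
  \<comment> \<open>A rational cutoff in the positive part: it is continuously differentiable,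
    vanishes for \<open>t \<le> 0\<close> and tends to 1 at infinity.\<close>
  define \<psi> where "\<psi> t = (max 0 t)\<^sup>2 / (1 + (max 0 t)\<^sup>2)" for t :: real
  define \<psi>' where "\<psi>' t = 2 * max 0 t / (1 + (max 0 t)\<^sup>2)\<^sup>2" for t :: real
  have pos: "1 + (max 0 t)\<^sup>2 > 0" for t :: real
    using zero_le_power2[of "max 0 t"] by linarith
  then have ne: "1 + (max 0 t)\<^sup>2 \<noteq> 0" for t :: real
    by (metis less_irrefl)
  have \<psi>_der: "(\<psi> has_real_derivative \<psi>' t) (at t)" for t
  proof -
    have sq: "((\<lambda>t::real. (max 0 t)\<^sup>2) has_real_derivative 2 * max 0 t) (at t)"
      using has_real_derivative_max_0_power[of 0 t] by (simp add: power2_eq_square)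
    show ?thesis
      unfolding \<psi>_def[abs_def] \<psi>'_def
      by (rule DERIV_cong[OF DERIV_divide[OF sq DERIV_add[OF DERIV_const sq] ne]])
         (simp add: power2_eq_square[of "1 + (max 0 t)\<^sup>2"] algebra_simps)
  qed
  have \<psi>_cont: "continuous_on UNIV \<psi>" "continuous_on UNIV \<psi>'"
    unfolding \<psi>_def[abs_def] \<psi>'_def[abs_def] using ne by (auto intro!: continuous_intros)
  have \<psi>_01: "0 \<le> \<psi> t" "\<psi> t \<le> 1" and \<psi>'_nonneg: "\<psi>' t \<ge> 0" for t
    using pos[of t] by (auto simp: \<psi>_def \<psi>'_def divide_le_eq)
  have cont_g: "continuous_on (closure \<Omega>) (\<lambda>x. \<psi> (- \<rho> x / \<delta> - 1) * f x + 2 * K * \<delta>)" if "\<delta> > 0" for \<delta>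
  proof -
    have "continuous_on (closure \<Omega>) (\<lambda>x. - \<rho> x / \<delta> - 1)"
      using that by (intro continuous_intros continuous_on_subset[OF cont\<rho>]) auto
    then show ?thesis
      by (intro continuous_on_add continuous_on_mult f continuous_on_const
          continuous_on_compose2[OF \<psi>_cont(1)]) auto
  qed
  \<comment> \<open>The truncated field vanishes where \<open>- \<delta> < \<rho>\<close>, so its
    divergence has integral zero. The part of the divergence that contains the gradient of the
    cutoff is at most \<open>2 * K * \<delta>\<close>.\<close>
  have step: "0 \<le> integral \<Omega> (\<lambda>x. \<psi> (- \<rho> x / \<delta> - 1) * f x + 2 * K * \<delta>)" (is "0 \<le> integral \<Omega> ?g")
    if \<delta>: "\<delta> > 0" for \<delta>
  proof -
    let ?\<chi> = "\<lambda>s. \<psi> (- s / \<delta> - 1)" and ?\<chi>' = "\<lambda>s. - \<psi>' (- s / \<delta> - 1) / \<delta>"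
    let ?w = "\<lambda>x. ?\<chi> (\<rho> x) * f x + (?\<chi>' (\<rho> x) *\<^sub>R grad \<rho> x) \<bullet> F x"
    have "has_grad \<Omega> (\<lambda>x. ?\<chi> (\<rho> x)) (\<lambda>x. ?\<chi>' (\<rho> x) *\<^sub>R grad \<rho> x)"
    proof (rule has_grad_compose[OF \<rho>_grad, where S = UNIV])
      show "continuous_on UNIV ?\<chi>" "continuous_on UNIV ?\<chi>'"
        using \<delta> by (auto intro!: continuous_intros continuous_on_compose2[OF \<psi>_cont(1)]
            continuous_on_compose2[OF \<psi>_cont(2)])
      show "(?\<chi> has_real_derivative ?\<chi>' t) (at t)" for t
      proof -
        have "((\<lambda>s. - s / \<delta> - 1) has_real_derivative - 1 / \<delta>) (at t)"
          using \<delta> by (auto intro!: derivative_eq_intros)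
        from DERIV_chain2[OF \<psi>_der this] show ?thesis by simp
      qed
    qed simp
    then have div: "has_div \<Omega> (\<lambda>x. ?\<chi> (\<rho> x) *\<^sub>R F x) ?w"
      by (rule has_div_scaleR[OF bdd _ F])
    have w0: "(?w has_integral 0) \<Omega>"
    proof (rule integral_div_eq_0[OF op bdd div, where K = "{x. \<rho> x \<le> - \<delta>}"])
      show "closed {x. \<rho> x \<le> - \<delta>}"
        using cont\<rho> by (intro closed_Collect_le) auto
      show "{x. \<rho> x \<le> - \<delta>} \<subseteq> \<Omega>"
        using \<delta> \<Omega> by auto
      fix x assume "x \<in> \<Omega> - {x. \<rho> x \<le> - \<delta>}"
      then have "- \<rho> x / \<delta> - 1 \<le> 0"
        using \<delta> by (auto simp: le_divide_eq)
      then show "?\<chi> (\<rho> x) *\<^sub>R F x = 0"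
        by (simp add: \<psi>_def)
    qed
    have int: "?g integrable_on \<Omega>"
      by (intro continuous_on_closure_integrable op bdd cont_g \<delta>)
    have "?w x \<le> ?g x" if x: "x \<in> \<Omega>" for x
    proof -
      let ?t = "- \<rho> x / \<delta> - 1"
      have "x \<in> closure \<Omega>" using x closure_subset by blast
      from mult_left_mono[OF K(2)[OF this] \<psi>'_nonneg[of ?t]]
      have "- (\<psi>' ?t * (F x \<bullet> grad \<rho> x)) \<le> K * (\<psi>' ?t * (\<rho> x)\<^sup>2)"
        by (simp add: algebra_simps)
      also have "\<psi>' ?t * (\<rho> x)\<^sup>2 \<le> 2 * \<delta>\<^sup>2"
      proof -
        have "\<rho> x = - \<delta> * (?t + 1)"
          using \<delta> by simp
        then have "(\<rho> x)\<^sup>2 = \<delta>\<^sup>2 * (?t + 1)\<^sup>2"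
          by (metis power_mult_distrib power2_minus mult_minus_left)
        then have "\<psi>' ?t * (\<rho> x)\<^sup>2 = 2 * \<delta>\<^sup>2 * (max 0 ?t / (1 + (max 0 ?t)\<^sup>2)\<^sup>2 * (?t + 1)\<^sup>2)"
          by (simp add: \<psi>'_def)
        also have "\<dots> \<le> 2 * \<delta>\<^sup>2 * 1"
          by (intro mult_left_mono cutoff_estimate) simp
        finally show ?thesis by simp
      qed
      finally have "- (\<psi>' ?t * (F x \<bullet> grad \<rho> x)) \<le> (2 * K * \<delta>) * \<delta>"
        using K(1) by (simp add: mult_left_mono power2_eq_square mult.assoc)
      then have "- (\<psi>' ?t * (F x \<bullet> grad \<rho> x)) / \<delta> \<le> 2 * K * \<delta>"
        using \<delta> by (subst pos_divide_le_eq)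
      then show ?thesis
        by (simp add: inner_commute)
    qed
    with w0 int show ?thesis
      by (metis (no_types, lifting) has_integral_le has_integral_integral)
  qed
  define \<delta> where "\<delta> k = inverse (real (Suc k))" for k
  have \<delta>: "\<delta> k > 0" "\<delta> k \<le> 1" for k by (auto simp: \<delta>_def field_simps)
  have \<delta>_lim: "\<delta> \<longlonglongrightarrow> 0" unfolding \<delta>_def by (rule LIMSEQ_inverse_real_of_nat)
  obtain M where M: "\<And>x. x \<in> closure \<Omega> \<Longrightarrow> norm (f x) \<le> M"
    using bounded_on_closure[OF bdd f] by blast
  have "(\<lambda>k. integral \<Omega> (\<lambda>x. \<psi> (- \<rho> x / \<delta> k - 1) * f x + 2 * K * \<delta> k)) \<longlonglongrightarrow> integral \<Omega> f"
  proof (rule dominated_convergence(2)[where h = "\<lambda>_. M + 2 * K"])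
    show "(\<lambda>x. \<psi> (- \<rho> x / \<delta> k - 1) * f x + 2 * K * \<delta> k) integrable_on \<Omega>" for k
      by (intro continuous_on_closure_integrable op bdd cont_g \<delta>)
    show "(\<lambda>_. M + 2 * K) integrable_on \<Omega>"
      by (intro continuous_on_closure_integrable op bdd continuous_intros)
    fix x assume x: "x \<in> \<Omega>"
    then have "\<bar>f x\<bar> \<le> M" using M closure_subset by fastforce
    show "norm (\<psi> (- \<rho> x / \<delta> k - 1) * f x + 2 * K * \<delta> k) \<le> M + 2 * K" for k
    proof -
      have "\<bar>\<psi> (- \<rho> x / \<delta> k - 1) * f x\<bar> \<le> 1 * M"
        unfolding abs_mult using \<psi>_01 \<open>\<bar>f x\<bar> \<le> M\<close> by (intro mult_mono) auto
      moreover have "\<bar>2 * K * \<delta> k\<bar> \<le> 2 * K"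
        using K(1) \<delta>[of k] by (simp add: abs_mult mult_left_le)
      ultimately show ?thesis
        by (simp add: abs_le_iff)
    qed
    \<comment> \<open>At a fixed interior point \<open>\<rho> x < 0\<close>, so the argument of the
      cutoff tends to infinity as \<delta> tends to 0.\<close>
    have "filterlim (\<lambda>k. - \<rho> x / \<delta> k - 1) at_top sequentially"
    proof -
      have "- \<rho> x > 0" using x \<Omega> by auto
      moreover have "filterlim (\<lambda>k. real (Suc k)) at_top sequentially"
        using filterlim_real_sequentially filterlim_sequentially_Suc by blast
      ultimately have "filterlim (\<lambda>k. - 1 + - \<rho> x * real (Suc k)) at_top sequentially"
        by (rule filterlim_tendsto_add_at_top[OF tendsto_const filterlim_tendsto_pos_mult_at_top[OF tendsto_const]])
      moreover have "- \<rho> x / \<delta> k - 1 = - 1 + - \<rho> x * real (Suc k)" for k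
        by (simp add: \<delta>_def divide_inverse)
      ultimately show ?thesis
        by (simp only:)
    qed
    moreover have "(\<psi> \<longlongrightarrow> 1) at_top"
    proof -
      have "((\<lambda>t::real. t\<^sup>2 / (1 + t\<^sup>2)) \<longlongrightarrow> 1) at_top" by real_asymp
      moreover have "eventually (\<lambda>t. t\<^sup>2 / (1 + t\<^sup>2) = \<psi> t) at_top"
        using eventually_ge_at_top[of 0] by eventually_elim (simp add: \<psi>_def)
      ultimately show ?thesis by (rule Lim_transform_eventually)
    qed
    ultimately have "(\<lambda>k. \<psi> (- \<rho> x / \<delta> k - 1)) \<longlonglongrightarrow> 1"
      by (rule filterlim_compose[rotated])
    then show "(\<lambda>k. \<psi> (- \<rho> x / \<delta> k - 1) * f x + 2 * K * \<delta> k) \<longlonglongrightarrow> f x"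
      using \<delta>_lim by (auto intro!: tendsto_eq_intros)
  qed
  then show ?thesis
    using step[OF \<delta>(1)] by (intro LIMSEQ_le_const) auto
qed

text \<open>Adding \<open>\<delta> *\<^sub>R grad \<rho>\<close> to \<open>F\<close> raises its
  product with \<open>grad \<rho>\<close> by \<delta> times the squared norm of
  \<open>grad \<rho>\<close>, which is positive on the frontier. The strict version applies, and
  \<delta> tends to 0.\<close>

lemma flux_nonneg:
  assumes dom: "smooth_domain \<Omega> \<rho>"
    and F: "has_div \<Omega> F f" and f: "continuous_on (closure \<Omega>) f"
    and bd: "\<And>x. x \<in> frontier \<Omega> \<Longrightarrow> 0 \<le> F x \<bullet> grad \<rho> x"
  shows "0 \<le> integral \<Omega> f"
proof -
  have op: "open \<Omega>" and bdd: "bounded \<Omega>" and sm: "smooth_fun \<rho>"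
    using dom unfolding smooth_domain_def by auto
  obtain l where l: "has_div \<Omega> (grad \<rho>) l" and contl: "continuous_on (closure \<Omega>) l"
    using smooth_fun_has_div_grad[OF sm bdd] by blast
  have "0 \<le> integral \<Omega> f + \<delta> * integral \<Omega> l" if \<delta>: "\<delta> > 0" for \<delta>
  proof -
    have div: "has_div \<Omega> (\<lambda>x. F x + \<delta> *\<^sub>R grad \<rho> x) (\<lambda>x. f x + \<delta> * l x)"
      using has_div_add[OF F has_div_scaleR[OF bdd has_grad_const l, of \<delta>]] by simp
    have "0 \<le> integral \<Omega> (\<lambda>x. f x + \<delta> * l x)"
    proof (rule flux_nonneg_strict[OF dom div])
      show "continuous_on (closure \<Omega>) (\<lambda>x. f x + \<delta> * l x)"
        using f contl by (intro continuous_intros)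
      fix x assume x: "x \<in> frontier \<Omega>"
      then have "\<rho> x = 0"
        by (rule smooth_domain_frontier[OF dom])
      then have "grad \<rho> x \<noteq> 0"
        using dom unfolding smooth_domain_def by blast
      then have "\<delta> * (grad \<rho> x \<bullet> grad \<rho> x) > 0"
        using \<delta> by simp
      with bd[OF x] show "0 < (F x + \<delta> *\<^sub>R grad \<rho> x) \<bullet> grad \<rho> x"
        by (simp add: inner_add_left)
    qed
    also have "\<dots> = integral \<Omega> f + \<delta> * integral \<Omega> l"
      using continuous_on_closure_integrable[OF op bdd f] continuous_on_closure_integrable[OF op bdd contl]
      by (subst integral_add) (auto intro: integrable_on_mult_right)
    finally show ?thesis .
  qed
  moreover have "((\<lambda>\<delta>. integral \<Omega> f + \<delta> * integral \<Omega> l) \<longlongrightarrow> integral \<Omega> f) (at_right 0)"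
    by (auto intro!: tendsto_eq_intros)
  ultimately show ?thesis
    by (intro tendsto_lowerbound[of _ _ "at_right (0::real)"])
       (auto simp: eventually_at_filter)
qed

section \<open>Solutions and the integral of the weight\<close>

lemma holder_on_continuous_on:
  assumes "holder_on th S f" and "th > 0"
  shows "continuous_on S f"
  unfolding continuous_on_def
proof
  fix x assume x: "x \<in> S"
  obtain C where C: "\<forall>x\<in>S. \<forall>y\<in>S. \<bar>f x - f y\<bar> \<le> C * dist x y powr th"
    using assms(1) unfolding holder_on_def by blast
  have lim: "((\<lambda>y. C * dist y x powr th) \<longlongrightarrow> 0) (at x within S)"
  proof -
    have "((\<lambda>y. dist y x) \<longlongrightarrow> 0) (at x within S)"
      by (intro tendsto_eq_intros) auto
    then have "((\<lambda>y. dist y x powr th) \<longlongrightarrow> 0) (at x within S)"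
      using assms(2) by (intro tendsto_zero_powrI[where b = th]) auto
    then show ?thesis
      using tendsto_mult_right_zero by blast
  qed
  have "((\<lambda>y. f y - f x) \<longlongrightarrow> 0) (at x within S)"
  proof (rule Lim_null_comparison[OF _ lim])
    show "\<forall>\<^sub>F y in at x within S. norm (f y - f x) \<le> C * dist y x powr th"
      using C x by (auto simp: eventually_at_filter)
  qed
  then show "(f \<longlongrightarrow> f x) (at x within S)"
    by (simp add: LIM_zero_iff)
qed

text \<open>Translates a solution into the calculus of \<open>has_grad\<close> and
  \<open>has_div\<close>. Hoelder continuity on the compact closure bounds the diagonal of the
  Hessian, and multiplying the boundary condition by \<open>norm (grad \<rho> x)\<close> removes the
  normalization of the normal.\<close>

lemma is_solutionE:
  assumes dom: "smooth_domain \<Omega> \<rho>" and sol: "is_solution \<Omega> \<rho> a \<alpha> q u"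
  obtains Du where "has_grad \<Omega> u Du" and "has_div \<Omega> Du (\<lambda>x. - (a x * u x powr q))"
    and "\<And>x. x \<in> closure \<Omega> \<Longrightarrow> 0 \<le> u x"
    and "\<And>x. x \<in> frontier \<Omega> \<Longrightarrow> Du x \<bullet> grad \<rho> x = \<alpha> * u x * norm (grad \<rho> x)"
proof -
  have op: "open \<Omega>" and bdd: "bounded \<Omega>" and sm: "smooth_fun \<rho>"
    using dom unfolding smooth_domain_def by auto
  obtain r Du D2u where r: "0 < r" and data: "C2r_data r \<Omega> u Du D2u"
    and nonneg: "\<forall>x\<in>\<Omega>. u x \<ge> 0"
    and eq: "\<forall>x\<in>\<Omega>. - (\<Sum>i\<in>Basis. D2u x i \<bullet> i) = a x * u x powr q"
    and bc: "\<forall>x\<in>frontier \<Omega>. Du x \<bullet> outer_normal \<rho> x = \<alpha> * u x"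
    using sol unfolding is_solution_def by blast
  have grad: "has_grad \<Omega> u Du"
    using data unfolding C2r_data_def has_grad_def by blast
  have "continuous_on (closure \<Omega>) (\<lambda>x. D2u x i \<bullet> i)" if "i \<in> Basis" for i
    using data that r unfolding C2r_data_def by (blast intro: holder_on_continuous_on)
  then have "\<forall>i\<in>Basis. \<exists>M. \<forall>x\<in>closure \<Omega>. norm (D2u x i \<bullet> i) \<le> M"
    using bounded_on_closure[OF bdd] by metis
  then obtain M where M: "\<And>i x. i \<in> Basis \<Longrightarrow> x \<in> closure \<Omega> \<Longrightarrow> norm (D2u x i \<bullet> i) \<le> M i"
    by metis
  have div: "has_div \<Omega> Du (\<lambda>x. - (a x * u x powr q))"
  proof (rule has_divI[where X' = D2u and B = "\<Sum>j\<in>Basis. \<bar>M j\<bar>"])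
    show "continuous_on (closure \<Omega>) Du"
      using grad unfolding has_grad_def by blast
    fix x assume x: "x \<in> \<Omega>"
    show "(Du has_derivative D2u x) (at x)"
      using data x unfolding C2r_data_def by blast
    show "- (a x * u x powr q) = (\<Sum>i\<in>Basis. D2u x i \<bullet> i)"
      using eq x by (metis minus_minus)
    fix i :: 'a assume i: "i \<in> Basis"
    have "\<bar>D2u x i \<bullet> i\<bar> \<le> \<bar>M i\<bar>"
      using M[OF i, of x] x closure_subset[of \<Omega>] by (auto simp: subset_eq)
    also have "\<dots> \<le> (\<Sum>j\<in>Basis. \<bar>M j\<bar>)"
      using i by (intro member_le_sum) auto
    finally show "\<bar>D2u x i \<bullet> i\<bar> \<le> (\<Sum>j\<in>Basis. \<bar>M j\<bar>)" .
  qed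
  have "0 \<le> u x" if "x \<in> closure \<Omega>" for x
    using grad that nonneg unfolding has_grad_def by (blast intro: continuous_ge_on_closure)
  moreover have "Du x \<bullet> grad \<rho> x = \<alpha> * u x * norm (grad \<rho> x)" if x: "x \<in> frontier \<Omega>" for x
  proof -
    have "\<rho> x = 0"
      using x by (rule smooth_domain_frontier[OF dom])
    then have "norm (grad \<rho> x) \<noteq> 0"
      using dom unfolding smooth_domain_def by auto
    moreover have "Du x \<bullet> outer_normal \<rho> x = \<alpha> * u x"
      using bc x by blast
    ultimately show ?thesis
      unfolding outer_normal_def by (simp add: field_simps)
  qed
  ultimately show ?thesis
    using that grad div by blast
qed

text \<open>Applied to the gradient of a solution, this says that a constant solution has
  \<open>a x * u x powr q = 0\<close> throughout, which is impossible where both \<open>a\<close>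
  and \<open>u\<close> are positive.\<close>

lemma has_div_locally_constant:
  assumes "open \<Omega>" and div: "has_div \<Omega> X f" and X: "\<And>x. x \<in> \<Omega> \<Longrightarrow> X x = 0" and x: "x \<in> \<Omega>"
  shows "f x = 0"
proof -
  obtain X' B where X': "continuous_on (closure \<Omega>) X"
    "\<And>x. x \<in> \<Omega> \<Longrightarrow> (X has_derivative X' x) (at x)"
    "\<And>x. x \<in> \<Omega> \<Longrightarrow> f x = (\<Sum>i\<in>Basis. X' x i \<bullet> i)"
    "\<And>x i. x \<in> \<Omega> \<Longrightarrow> i \<in> Basis \<Longrightarrow> \<bar>X' x i \<bullet> i\<bar> \<le> B"
    using div by (rule has_divE) (rule that; blast)
  have "(X has_derivative (\<lambda>_. 0)) (at x)"
    by (rule has_derivative_transform_within_open[where f = "\<lambda>_. 0" and s = \<Omega>]) (use assms in auto)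
  then have "X' x = (\<lambda>_. 0)"
    using X'(2)[OF x] has_derivative_unique by blast
  then show ?thesis
    using X'(3)[OF x] by simp
qed

section \<open>Testing the equation with negative powers of the solution\<close>

lemma has_grad_powr:
  assumes g: "has_grad \<Omega> g G" and pos: "\<And>x. x \<in> closure \<Omega> \<Longrightarrow> 0 < g x + e"
  shows "has_grad \<Omega> (\<lambda>x. (g x + e) powr s) (\<lambda>x. (s * (g x + e) powr (s - 1)) *\<^sub>R G x)"
proof (rule has_grad_compose[OF g, where S = "{- e<..}" and \<phi> = "\<lambda>t. (t + e) powr s" and \<phi>' = "\<lambda>t. s * (t + e) powr (s - 1)"])
  show "continuous_on {- e<..} (\<lambda>t. (t + e) powr s)" "continuous_on {- e<..} (\<lambda>t. s * (t + e) powr (s - 1))"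
    by (auto intro!: continuous_intros)
  show "g ` closure \<Omega> \<subseteq> {- e<..}"
    using pos by force
  show "((\<lambda>t. (t + e) powr s) has_real_derivative s * (t + e) powr (s - 1)) (at t)" if "t \<in> {- e<..}" for t
    using that by (auto intro!: derivative_eq_intros)
qed

text \<open>The bound depends on \<open>f\<close> only through \<eta>, so one bound can serve a
  whole sequence of functions on a fixed ball.\<close>

lemma integral_ge_cball:
  fixes f :: "'a::euclidean_space \<Rightarrow> real"
  assumes int: "f integrable_on \<Omega>" and nonneg: "\<And>x. x \<in> \<Omega> \<Longrightarrow> 0 \<le> f x"
    and sub: "cball x r \<subseteq> \<Omega>" and ge: "\<And>y. y \<in> cball x r \<Longrightarrow> \<eta> \<le> f y"
  shows "\<eta> * measure lborel (cball x r) \<le> integral \<Omega> f"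
proof -
  have "((\<lambda>_. 1) has_integral measure lborel (cball x r)) (cball x r)"
    using emeasure_lborel_cball_finite by (intro has_integral_measure_lborel) auto
  then have "((\<lambda>_. \<eta> * 1) has_integral \<eta> * measure lborel (cball x r)) (cball x r)"
    by (rule has_integral_mult_right)
  then have "((\<lambda>y. if y \<in> cball x r then \<eta> * 1 else 0) has_integral \<eta> * measure lborel (cball x r)) \<Omega>"
    by (subst has_integral_restrict[OF sub])
  then show ?thesis
    using integrable_integral[OF int] by (rule has_integral_le) (use ge nonneg in auto)
qed

lemma integral_pos_of_continuous:
  fixes f :: "'a::euclidean_space \<Rightarrow> real"
  assumes op: "open \<Omega>" and bdd: "bounded \<Omega>" and f: "continuous_on (closure \<Omega>) f"
    and nonneg: "\<And>x. x \<in> \<Omega> \<Longrightarrow> 0 \<le> f x" and x: "x \<in> \<Omega>" "0 < f x"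
  shows "0 < integral \<Omega> f"
proof -
  have "continuous_on \<Omega> f"
    using f closure_subset continuous_on_subset by blast
  then have "open (\<Omega> \<inter> f -` {f x / 2<..})"
    by (intro continuous_open_preimage op open_greaterThan)
  moreover have "x \<in> \<Omega> \<inter> f -` {f x / 2<..}"
    using x by auto
  ultimately obtain r where r: "r > 0" "cball x r \<subseteq> \<Omega> \<inter> f -` {f x / 2<..}"
    using open_contains_cball by blast
  have "f x / 2 * measure lborel (cball x r) \<le> integral \<Omega> f"
    using r continuous_on_closure_integrable[OF op bdd f] nonneg
    by (intro integral_ge_cball) (auto simp: subset_eq less_imp_le)
  moreover have "0 < f x / 2 * measure lborel (cball x r)"
    using x content_cball_pos[OF r(1), of x] by simp
  ultimately show ?thesis by linarith
qed

text \<open>The equation tested with \<open>(u + \<epsilon>) powr (- q)\<close> contains \<open>a\<close> only with a weight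
  in \<open>[0, 1]\<close>; on \<open>{a > 0}\<close> the weight tends to \<open>1\<close>, and on \<open>{a \<le> 0}\<close> the error has a sign.\<close>
lemma weight_bounds:
  assumes "0 \<le> u" and "0 < e" and "0 < (q::real)"
  shows "0 \<le> u powr q * (u + e) powr (- q)" and "u powr q * (u + e) powr (- q) \<le> 1"
proof -
  have "u powr q * (u + e) powr (- q) \<le> (u + e) powr q * (u + e) powr (- q)"
    using assms by (intro mult_right_mono powr_mono2) auto
  also have "\<dots> = 1"
    using assms by (simp flip: powr_add)
  finally show "u powr q * (u + e) powr (- q) \<le> 1" .
qed simp

text \<open>Where \<open>a x > 0\<close>, positivity of \<open>u x\<close> makes the weight tend to
  1; elsewhere the factor \<open>max 0 (a x)\<close> vanishes. A bound for \<open>a\<close>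
  dominates, since the weight lies between 0 and 1.\<close>

lemma integral_defect_tendsto_0:
  fixes a u :: "'a::euclidean_space \<Rightarrow> real"
  assumes op: "open \<Omega>" and bdd: "bounded \<Omega>" and q: "0 < q"
    and a: "continuous_on (closure \<Omega>) a" and u: "continuous_on (closure \<Omega>) u"
    and nonneg: "\<And>x. x \<in> closure \<Omega> \<Longrightarrow> 0 \<le> u x" and pos: "\<And>x. x \<in> \<Omega> \<Longrightarrow> a x > 0 \<Longrightarrow> u x > 0"
    and \<epsilon>: "\<And>k. 0 < \<epsilon> k" "\<epsilon> \<longlonglongrightarrow> 0"
  shows "(\<lambda>x. max 0 (a x) * (1 - u x powr q * (u x + \<epsilon> k) powr (- q))) integrable_on \<Omega>"
    and "(\<lambda>k. integral \<Omega> (\<lambda>x. max 0 (a x) * (1 - u x powr q * (u x + \<epsilon> k) powr (- q)))) \<longlonglongrightarrow> 0"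
proof -
  obtain M where M: "\<And>x. x \<in> closure \<Omega> \<Longrightarrow> norm (a x) \<le> M"
    using bounded_on_closure[OF bdd a] by blast
  have ne: "u x + \<epsilon> k \<noteq> 0" if "x \<in> closure \<Omega>" for x k
    using nonneg[OF that] \<epsilon>(1)[of k] by linarith
  show int: "(\<lambda>x. max 0 (a x) * (1 - u x powr q * (u x + \<epsilon> k) powr (- q))) integrable_on \<Omega>" for k
    using nonneg ne q by (intro continuous_on_closure_integrable op bdd continuous_intros a u continuous_on_powr') auto
  have "(\<lambda>k. integral \<Omega> (\<lambda>x. max 0 (a x) * (1 - u x powr q * (u x + \<epsilon> k) powr (- q)))) \<longlonglongrightarrow> integral \<Omega> (\<lambda>_. 0 :: real)"
  proof (rule dominated_convergence(2)[OF int])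
    show "(\<lambda>_. M) integrable_on \<Omega>"
      by (intro continuous_on_closure_integrable op bdd continuous_intros)
    fix x assume x: "x \<in> \<Omega>"
    then have xc: "x \<in> closure \<Omega>" using closure_subset by blast
    show "norm (max 0 (a x) * (1 - u x powr q * (u x + \<epsilon> k) powr (- q))) \<le> M" for k
    proof -
      have "\<bar>max 0 (a x)\<bar> * \<bar>1 - u x powr q * (u x + \<epsilon> k) powr (- q)\<bar> \<le> M * 1"
        using M[OF xc] weight_bounds[OF nonneg[OF xc] \<epsilon>(1)[of k] q] by (intro mult_mono) auto
      then show ?thesis by (simp add: abs_mult)
    qed
    show "(\<lambda>k. max 0 (a x) * (1 - u x powr q * (u x + \<epsilon> k) powr (- q))) \<longlonglongrightarrow> 0"
    proof (cases "a x > 0")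
      case True
      with pos x have ux: "u x > 0" by blast
      have "(\<lambda>k. max 0 (a x) * (1 - u x powr q * (u x + \<epsilon> k) powr (- q)))
          \<longlonglongrightarrow> max 0 (a x) * (1 - u x powr q * (u x + 0) powr (- q))"
        using ux by (intro tendsto_intros \<epsilon>(2)) auto
      moreover have "u x powr q * (u x + 0) powr (- q) = 1"
        using ux by (simp flip: powr_add)
      ultimately show ?thesis by simp
    qed (simp add: max_def)
  qed
  then show "(\<lambda>k. integral \<Omega> (\<lambda>x. max 0 (a x) * (1 - u x powr q * (u x + \<epsilon> k) powr (- q)))) \<longlonglongrightarrow> 0"
    by simp
qed

text \<open>The exponent \<open>- q\<close> turns the right-hand side into \<open>a\<close> times
  the weight of \<open>weight_bounds\<close>, and for \<open>q > 0\<close> the derivative of the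
  power leaves a gradient term of fixed sign. The shift \<open>e\<close> keeps the base positive at
  zeros of \<open>u\<close>; a positive solution allows \<open>e = 0\<close>.\<close>

lemma has_div_powr_grad:
  assumes bdd: "bounded \<Omega>" and grad: "has_grad \<Omega> u Du"
    and div: "has_div \<Omega> Du (\<lambda>x. - (a x * u x powr q))"
    and pos: "\<And>x. x \<in> closure \<Omega> \<Longrightarrow> 0 < u x + e"
  shows "has_div \<Omega> (\<lambda>x. (u x + e) powr (- q) *\<^sub>R Du x)
    (\<lambda>x. - (a x * (u x powr q * (u x + e) powr (- q))) - q * (u x + e) powr (- q - 1) * (Du x \<bullet> Du x))"
  using has_div_scaleR[OF bdd has_grad_powr[OF grad pos, where s = "- q"] div]
  by (rule has_div_cong) (simp_all add: algebra_simps)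

text \<open>Nonnegative flux bounds the integral of \<open>a\<close> plus a fixed positive gradient
  term by the integral of the defect, which tends to 0. The gradient term makes the final inequality
  strict.\<close>

lemma integral_weight_neg:
  fixes \<Omega> :: "'a::euclidean_space set"
  assumes dom: "smooth_domain \<Omega> \<rho>" and a: "continuous_on (closure \<Omega>) a"
    and a_pos: "\<exists>x\<in>\<Omega>. a x > 0" and \<alpha>: "\<alpha> \<ge> 0" and q: "0 < q"
    and sol: "is_solution \<Omega> \<rho> a \<alpha> q u" and pos: "\<And>x. x \<in> \<Omega> \<Longrightarrow> a x > 0 \<Longrightarrow> u x > 0"
  shows "integral \<Omega> a < 0"
proof -
  have op: "open \<Omega>" and bdd: "bounded \<Omega>"
    using dom unfolding smooth_domain_def by auto
  obtain Du where grad: "has_grad \<Omega> u Du" and div: "has_div \<Omega> Du (\<lambda>x. - (a x * u x powr q))"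
    and nonneg: "\<And>x. x \<in> closure \<Omega> \<Longrightarrow> 0 \<le> u x"
    and bc: "\<And>x. x \<in> frontier \<Omega> \<Longrightarrow> Du x \<bullet> grad \<rho> x = \<alpha> * u x * norm (grad \<rho> x)"
    by (rule is_solutionE[OF dom sol]) (rule that; blast)
  have u: "continuous_on (closure \<Omega>) u" and Du: "continuous_on (closure \<Omega>) Du"
    using grad unfolding has_grad_def by blast+
  \<comment> \<open>Since \<open>\<epsilon> k \<le> 1\<close> and the exponent is negative, the base
    \<open>u x + 1\<close> gives a lower bound for the gradient term that is uniform in
    \<open>k\<close>.\<close>
  let ?J = "\<lambda>x. (u x + 1) powr (- q - 1) * (Du x \<bullet> Du x)"
  have ne: "u x + e \<noteq> 0" if "x \<in> closure \<Omega>" "e > 0" for x e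
    using nonneg[OF that(1)] that(2) by linarith
  have contJ: "continuous_on (closure \<Omega>) ?J"
    using nonneg ne by (intro continuous_intros continuous_on_powr' u Du) (auto intro: add_nonneg_nonneg)
  \<comment> \<open>If the gradient vanished identically, the equation would give
    \<open>a x * u x powr q = 0\<close> everywhere, contrary to the positivity of \<open>u\<close>
    where \<open>a\<close> is positive.\<close>
  obtain x0 where x0: "x0 \<in> \<Omega>" "Du x0 \<noteq> 0"
    using a_pos has_div_locally_constant[OF op div] pos by fastforce
  have J_pos: "0 < integral \<Omega> ?J"
  proof (rule integral_pos_of_continuous[OF op bdd contJ])
    show "0 < ?J x0"
      using x0 nonneg[of x0] closure_subset[of \<Omega>] by (auto intro!: mult_pos_pos)
  qed (use x0 in auto)
  define \<epsilon> where "\<epsilon> k = inverse (real (Suc k))" for k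
  have \<epsilon>: "\<epsilon> k > 0" "\<epsilon> k \<le> 1" for k by (auto simp: \<epsilon>_def field_simps)
  have \<epsilon>_lim: "\<epsilon> \<longlonglongrightarrow> 0" unfolding \<epsilon>_def by (rule LIMSEQ_inverse_real_of_nat)
  let ?T = "\<lambda>k x. max 0 (a x) * (1 - u x powr q * (u x + \<epsilon> k) powr (- q))"
  note T = integral_defect_tendsto_0[where \<epsilon> = \<epsilon>, OF op bdd q a u nonneg pos \<epsilon>(1) \<epsilon>_lim]
  have a_int: "a integrable_on \<Omega>" and J_int: "?J integrable_on \<Omega>"
    using continuous_on_closure_integrable[OF op bdd] a contJ by blast+
  have "integral \<Omega> a + q * integral \<Omega> ?J \<le> integral \<Omega> (?T k)" for k
  proof -
    let ?X = "\<lambda>x. (u x + \<epsilon> k) powr (- q) *\<^sub>R Du x"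
    let ?f = "\<lambda>x. - (a x * (u x powr q * (u x + \<epsilon> k) powr (- q))) - q * (u x + \<epsilon> k) powr (- q - 1) * (Du x \<bullet> Du x)"
    have pos_k: "0 < u x + \<epsilon> k" if "x \<in> closure \<Omega>" for x
      using nonneg[OF that] \<epsilon>(1)[of k] by linarith
    have contf: "continuous_on (closure \<Omega>) ?f"
      using nonneg pos_k q by (intro continuous_intros continuous_on_powr' a u Du) (auto simp: less_imp_le less_imp_neq[symmetric])
    have "0 \<le> integral \<Omega> ?f"
    proof (rule flux_nonneg[OF dom has_div_powr_grad[OF bdd grad div pos_k] contf])
      fix x assume x: "x \<in> frontier \<Omega>"
      then have "0 \<le> u x"
        using nonneg by (auto simp: frontier_def)
      then show "0 \<le> ?X x \<bullet> grad \<rho> x"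
        using bc[OF x] \<alpha> by simp
    qed
    also have "integral \<Omega> ?f \<le> integral \<Omega> (\<lambda>x. ?T k x - (a x + q * ?J x))"
    proof (rule integral_le)
      show "?f integrable_on \<Omega>"
        by (rule continuous_on_closure_integrable[OF op bdd contf])
      show "(\<lambda>x. ?T k x - (a x + q * ?J x)) integrable_on \<Omega>"
        by (intro integrable_diff integrable_add T(1) a_int integrable_on_mult_right J_int)
      fix x assume x: "x \<in> \<Omega>"
      then have xc: "x \<in> closure \<Omega>" using closure_subset by blast
      define s where "s = u x powr q * (u x + \<epsilon> k) powr (- q)"
      have s: "0 \<le> s" "s \<le> 1"
        unfolding s_def using weight_bounds[OF nonneg[OF xc] \<epsilon>(1)[of k] q] by auto
      have "(u x + 1) powr (- q - 1) \<le> (u x + \<epsilon> k) powr (- q - 1)"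
        using \<epsilon>[of k] nonneg[OF xc] q by (intro powr_mono2') auto
      then have "q * ?J x \<le> q * ((u x + \<epsilon> k) powr (- q - 1) * (Du x \<bullet> Du x))"
        using q by (intro mult_left_mono mult_right_mono) auto
      \<comment> \<open>For \<open>a x > 0\<close> this is an equality; for
        \<open>a x \<le> 0\<close> it says that \<open>- a x\<close> times \<open>1 - s\<close> is
        nonnegative.\<close>
      moreover have "- (a x * s) \<le> max 0 (a x) * (1 - s) - a x"
        using s mult_nonneg_nonneg[of "- a x" "1 - s"] by (cases "a x > 0") (auto simp: algebra_simps max_def)
      ultimately show "?f x \<le> ?T k x - (a x + q * ?J x)"
        unfolding s_def by (simp add: mult.assoc)
    qed
    also have "\<dots> = integral \<Omega> (?T k) - (integral \<Omega> a + q * integral \<Omega> ?J)"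
      using T(1)[of k] a_int J_int
      by (simp add: integral_diff integral_add integrable_add integrable_on_mult_right)
    finally show ?thesis by simp
  qed
  then have "integral \<Omega> a + q * integral \<Omega> ?J \<le> 0"
    by (intro LIMSEQ_le_const[OF T(2)]) auto
  moreover have "0 < q * integral \<Omega> ?J"
    using q J_pos by simp
  ultimately show ?thesis by linarith
qed

section \<open>Comparison with the Neumann problem\<close>

text \<open>A Picone-type identity: for positive \<open>A\<close> and \<open>B\<close> the left side
  falls short of the squared norm of \<open>p - s\<close> by an explicit nonnegative square.\<close>

lemma quadratic_over_linear_identity:
  fixes p s :: "'a::real_inner" and A B :: real
  assumes "A \<noteq> 0" and "B \<noteq> 0"
  shows "(A - B) * ((p \<bullet> p) / A - (s \<bullet> s) / B) =
    (p - s) \<bullet> (p - s) - ((B *\<^sub>R p - A *\<^sub>R s) \<bullet> (B *\<^sub>R p - A *\<^sub>R s)) / (A * B)"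
  using assms
  by (simp add: inner_diff_left inner_diff_right inner_commute[of s p] field_simps)

text \<open>For \<open>A\<close> and \<open>B\<close> with gradients \<open>p\<close> and
  \<open>s\<close>, the first term is the gradient of \<open>max 0 (A - B) ^ (n + 2)\<close> paired
  with \<open>p - s\<close>; the second is that power times the difference of the quadratic terms of
  the two transformed equations. As a function of free values, its sign is a matter of
  algebra.\<close>

definition picone_density :: "nat \<Rightarrow> real \<Rightarrow> real \<Rightarrow> real \<Rightarrow> 'a::real_inner \<Rightarrow> 'a \<Rightarrow> real" where
  "picone_density n c A B p s = real (n + 2) * max 0 (A - B) ^ (n + 1) * ((p - s) \<bullet> (p - s))
     - max 0 (A - B) ^ (n + 2) * (c * ((p \<bullet> p) / A - (s \<bullet> s) / B))"

text \<open>One factor \<open>A - B\<close> of the higher power is spent on the Picone-type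
  identity. The squared norm of \<open>p - s\<close> then has coefficient \<open>n + 2 - c\<close>,
  which explains the later choice of a large \<open>n\<close>.\<close>

lemma picone_density_eq:
  assumes "0 < B" and "B < A"
  shows "picone_density n c A B p s = (A - B) ^ (n + 1) * ((real (n + 2) - c) * ((p - s) \<bullet> (p - s))
    + c * (((B *\<^sub>R p - A *\<^sub>R s) \<bullet> (B *\<^sub>R p - A *\<^sub>R s)) / (A * B)))"
proof -
  have gen: "r * D ^ (n + 1) * N - D ^ (n + 2) * (c * P) = D ^ (n + 1) * (r * N - c * (D * P))" for r D N P :: real
    by (simp add: algebra_simps)
  have "max 0 (A - B) = A - B"
    using assms by simp
  then have "picone_density n c A B p s = (A - B) ^ (n + 1) *
      (real (n + 2) * ((p - s) \<bullet> (p - s)) - c * ((A - B) * ((p \<bullet> p) / A - (s \<bullet> s) / B)))"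
    unfolding picone_density_def by (simp only: gen)
  also have "(A - B) * ((p \<bullet> p) / A - (s \<bullet> s) / B) =
      (p - s) \<bullet> (p - s) - ((B *\<^sub>R p - A *\<^sub>R s) \<bullet> (B *\<^sub>R p - A *\<^sub>R s)) / (A * B)"
    using assms by (intro quadratic_over_linear_identity) auto
  also have "r * N - c * (N - W) = (r - c) * N + c * W" for r N W :: real
    by (simp add: algebra_simps)
  finally show ?thesis .
qed

lemma picone_density_nonneg:
  assumes "0 < A" and "0 < B" and "0 \<le> c" and "c < real (n + 2)"
  shows "0 \<le> picone_density n c A B p s"
proof (cases "B < A")
  case True
  then show ?thesis
    using assms unfolding picone_density_eq[OF assms(2) True]
    by (intro mult_nonneg_nonneg add_nonneg_nonneg zero_le_power divide_nonneg_nonneg inner_ge_zero) auto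
qed (simp add: picone_density_def)

text \<open>Both squares vanish only if \<open>p = s\<close> and
  \<open>(B - A) *\<^sub>R p = 0\<close>, hence only if both vectors are zero, as \<open>A\<close>
  and \<open>B\<close> differ.\<close>

lemma picone_density_pos:
  assumes "0 < B" and "B < A" and "0 < c" and "c < real (n + 2)" and "p \<noteq> 0 \<or> s \<noteq> 0"
  shows "0 < picone_density n c A B p s"
proof -
  let ?w = "B *\<^sub>R p - A *\<^sub>R s"
  have "0 < (real (n + 2) - c) * ((p - s) \<bullet> (p - s)) + c * ((?w \<bullet> ?w) / (A * B))"
  proof (cases "p = s")
    case True
    then have "?w = (B - A) *\<^sub>R p" and "p \<noteq> 0"
      using assms(5) by (auto simp: scaleR_left_diff_distrib)
    then have "?w \<noteq> 0" using assms(2) by simp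
    then have "0 < c * ((?w \<bullet> ?w) / (A * B))"
      using assms by (intro mult_pos_pos divide_pos_pos) auto
    then show ?thesis using True by simp
  next
    case False
    then have "0 < (real (n + 2) - c) * ((p - s) \<bullet> (p - s))"
      using assms by (intro mult_pos_pos) auto
    moreover have "0 \<le> c * ((?w \<bullet> ?w) / (A * B))"
      using assms by (intro mult_nonneg_nonneg divide_nonneg_nonneg) auto
    ultimately show ?thesis by linarith
  qed
  then show ?thesis
    using assms unfolding picone_density_eq[OF assms(1,2)] by (intro mult_pos_pos) auto
qed

lemma continuous_on_picone_density:
  assumes "continuous_on S A" "continuous_on S B" "continuous_on S p" "continuous_on S s"
    and "\<forall>x\<in>S. A x \<noteq> 0" "\<forall>x\<in>S. B x \<noteq> 0"
  shows "continuous_on S (\<lambda>x. picone_density n c (A x) (B x) (p x) (s x))"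
  unfolding picone_density_def by (intro continuous_intros assms)

lemma tendsto_picone_density:
  assumes "(A \<longlongrightarrow> A0) F" "(B \<longlongrightarrow> B0) F" "(p \<longlongrightarrow> p0) F" "(s \<longlongrightarrow> s0) F" "A0 \<noteq> 0" "B0 \<noteq> 0"
  shows "((\<lambda>x. picone_density n c (A x) (B x) (p x) (s x)) \<longlongrightarrow> picone_density n c A0 B0 p0 s0) F"
  unfolding picone_density_def by (intro tendsto_intros assms)

text \<open>In the variable \<open>u powr (1 - q) / (1 - q)\<close> the equation reads \<open>- \<Delta> w = a + c |\<nabla>w|\<^sup>2 / w\<close> with
  \<open>c = q / (1 - q)\<close>, so \<open>a\<close> cancels in the difference of two equations. The test function
  \<open>max 0 (w\<^sub>v - w\<^sub>u) ^ (n + 2)\<close> with \<open>n + 2 > c\<close> makes the remaining terms nonnegative.\<close>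
lemma integral_picone_density_le:
  fixes \<Omega> :: "'a::euclidean_space set" and n :: nat and a u v :: "'a \<Rightarrow> real" and Du Dv :: "'a \<Rightarrow> 'a" and e :: real
  assumes dom: "smooth_domain \<Omega> \<rho>" and a: "continuous_on (closure \<Omega>) a" and \<alpha>: "\<alpha> \<ge> 0"
    and q: "0 < q" "q < 1"
    and gu: "has_grad \<Omega> u Du" and du: "has_div \<Omega> Du (\<lambda>x. - (a x * u x powr q))"
    and u0: "\<And>x. x \<in> closure \<Omega> \<Longrightarrow> 0 \<le> u x"
    and bu: "\<And>x. x \<in> frontier \<Omega> \<Longrightarrow> Du x \<bullet> grad \<rho> x = \<alpha> * u x * norm (grad \<rho> x)"
    and gv: "has_grad \<Omega> v Dv" and dv: "has_div \<Omega> Dv (\<lambda>x. - (a x * v x powr q))"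
    and v0: "\<And>x. x \<in> closure \<Omega> \<Longrightarrow> 0 < v x"
    and bv: "\<And>x. x \<in> frontier \<Omega> \<Longrightarrow> Dv x \<bullet> grad \<rho> x = 0"
    and e: "0 < e" and M: "\<And>x. x \<in> closure \<Omega> \<Longrightarrow> v x powr (1 - q) / (1 - q) \<le> M"
    and T: "(\<lambda>x. max 0 (a x) * (1 - u x powr q * (u x + e) powr (- q))) integrable_on \<Omega>"
  defines "E \<equiv> \<lambda>x. picone_density n (q / (1 - q)) (v x powr (1 - q) / (1 - q)) ((u x + e) powr (1 - q) / (1 - q))
      (v x powr (- q) *\<^sub>R Dv x) ((u x + e) powr (- q) *\<^sub>R Du x)"
  shows "E integrable_on \<Omega>"
    and "integral \<Omega> E \<le> M ^ (n + 2) * integral \<Omega> (\<lambda>x. max 0 (a x) * (1 - u x powr q * (u x + e) powr (- q)))"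
proof -
  have op: "open \<Omega>" and bdd: "bounded \<Omega>"
    using dom unfolding smooth_domain_def by auto
  have cont: "continuous_on (closure \<Omega>) u" "continuous_on (closure \<Omega>) Du"
    "continuous_on (closure \<Omega>) v" "continuous_on (closure \<Omega>) Dv"
    using gu gv unfolding has_grad_def by blast+
  have ue: "0 < u x + e" if "x \<in> closure \<Omega>" for x
    using u0[OF that] e by linarith
  let ?A = "\<lambda>x. v x powr (1 - q) / (1 - q)" and ?B = "\<lambda>x. (u x + e) powr (1 - q) / (1 - q)"
  let ?Y = "\<lambda>x. v x powr (- q) *\<^sub>R Dv x" and ?X = "\<lambda>x. (u x + e) powr (- q) *\<^sub>R Du x"
  let ?s = "\<lambda>x. u x powr q * (u x + e) powr (- q)"
  let ?\<phi> = "\<lambda>x. max 0 (?A x - ?B x) ^ (n + 2)"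
  \<comment> \<open>The factor \<open>1 / (1 - q)\<close> is chosen so that the transformed function
    has gradient \<open>w powr (- q)\<close> times the gradient of \<open>w\<close>; thus
    \<open>?Y\<close> and \<open>?X\<close> are the gradients of \<open>?A\<close> and
    \<open>?B\<close>.\<close>
  have gw: "has_grad \<Omega> (\<lambda>x. w x powr (1 - q) / (1 - q)) (\<lambda>x. w x powr (- q) *\<^sub>R Dw x)"
    if "has_grad \<Omega> w Dw" "\<And>x. x \<in> closure \<Omega> \<Longrightarrow> 0 < w x" for w Dw
  proof -
    have "has_grad \<Omega> (\<lambda>x. (w x + 0) powr (1 - q)) (\<lambda>x. ((1 - q) * (w x + 0) powr (1 - q - 1)) *\<^sub>R Dw x)"
      using that by (intro has_grad_powr) auto
    then have "has_grad \<Omega> (\<lambda>x. (w x + 0) powr (1 - q) / (1 - q))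
        (\<lambda>x. (1 / (1 - q)) *\<^sub>R ((1 - q) * (w x + 0) powr (1 - q - 1)) *\<^sub>R Dw x)"
      by (rule has_grad_compose[where S = UNIV and \<phi> = "\<lambda>t. t / (1 - q)" and \<phi>' = "\<lambda>_. 1 / (1 - q)"])
         (use q in \<open>auto intro!: continuous_intros derivative_eq_intros\<close>)
    then show ?thesis using q by simp
  qed
  have gue: "has_grad \<Omega> (\<lambda>x. u x + e) Du"
    using gu unfolding has_grad_def by (auto intro!: continuous_intros derivative_eq_intros)
  have gA: "has_grad \<Omega> ?A ?Y" and gB: "has_grad \<Omega> ?B ?X"
    by (rule gw[OF gv v0] gw[OF gue ue]; assumption)+
  have gD: "has_grad \<Omega> ?\<phi> (\<lambda>x. (real (n + 2) * max 0 (?A x - ?B x) ^ (n + 1)) *\<^sub>R (?Y x - ?X x))"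
    by (rule has_grad_compose[OF has_grad_diff[OF gA gB], where S = UNIV and \<phi> = "\<lambda>t. max 0 t ^ (n + 2)"
        and \<phi>' = "\<lambda>t. real (n + 2) * max 0 t ^ (n + 1)"])
       (rule has_real_derivative_max_0_power subset_UNIV continuous_on_mult continuous_on_power
          continuous_on_max continuous_on_const continuous_on_id)+
  have dX: "has_div \<Omega> ?X (\<lambda>x. - (a x * ?s x) - q * (u x + e) powr (- q - 1) * (Du x \<bullet> Du x))"
    by (rule has_div_powr_grad[OF bdd gu du ue])
  have dY: "has_div \<Omega> ?Y (\<lambda>x. - a x - q * v x powr (- q - 1) * (Dv x \<bullet> Dv x))"
  proof (rule has_div_cong)
    show "has_div \<Omega> ?Y (\<lambda>x. - (a x * (v x powr q * v x powr (- q))) - q * v x powr (- q - 1) * (Dv x \<bullet> Dv x))"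
      using has_div_powr_grad[OF bdd gv dv, of 0] v0 by simp
    fix x assume "x \<in> \<Omega>"
    then have "v x > 0" using v0 closure_subset by blast
    then show "- (a x * (v x powr q * v x powr (- q))) - q * v x powr (- q - 1) * (Dv x \<bullet> Dv x)
        = - a x - q * v x powr (- q - 1) * (Dv x \<bullet> Dv x)"
      by (simp flip: powr_add)
  qed
  have "has_div \<Omega> (\<lambda>x. ?X x + (- 1) *\<^sub>R ?Y x) (\<lambda>x. (- (a x * ?s x) - q * (u x + e) powr (- q - 1) * (Du x \<bullet> Du x))
      + ((- 1) * (- a x - q * v x powr (- q - 1) * (Dv x \<bullet> Dv x)) + 0 \<bullet> ?Y x))"
    by (intro has_div_add dX has_div_scaleR bdd dY has_grad_const)
  \<comment> \<open>The difference of the transformed fields is multiplied by the test function. The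
    shift by \<open>e\<close> leaves \<open>a x * (1 - ?s x)\<close> where the weights would
    otherwise cancel.\<close>
  from has_div_scaleR[OF bdd gD this]
  have div: "has_div \<Omega> (\<lambda>x. ?\<phi> x *\<^sub>R (?X x + (- 1) *\<^sub>R ?Y x)) (\<lambda>x. ?\<phi> x * (a x * (1 - ?s x)) - E x)" (is "has_div \<Omega> ?F ?f")
  proof (rule has_div_cong)
    fix x assume "x \<in> \<Omega>"
    then have xc: "x \<in> closure \<Omega>" using closure_subset by blast
    \<comment> \<open>The quadratic term of the transformed equation, expressed in the original
      unknown.\<close>
    have key: "q / (1 - q) * ((w powr (- q) *\<^sub>R p) \<bullet> (w powr (- q) *\<^sub>R p) / (w powr (1 - q) / (1 - q)))
        = q * w powr (- q - 1) * (p \<bullet> p)" if "w > 0" for w :: real and p :: 'a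
    proof -
      have "w powr (- q - 1) * w powr (1 - q) = w powr (- q) * w powr (- q)"
        by (simp flip: powr_add)
      then have "w powr (- q) * w powr (- q) / w powr (1 - q) = w powr (- q - 1)"
        using that by (simp add: field_simps)
      moreover have "q / (1 - q) * ((w powr (- q) *\<^sub>R p) \<bullet> (w powr (- q) *\<^sub>R p) / (w powr (1 - q) / (1 - q)))
          = q * (w powr (- q) * w powr (- q) / w powr (1 - q)) * (p \<bullet> p)"
        using q by simp
      ultimately show ?thesis by simp
    qed
    have "q / (1 - q) * ((?Y x \<bullet> ?Y x) / ?A x - (?X x \<bullet> ?X x) / ?B x) =
        q * v x powr (- q - 1) * (Dv x \<bullet> Dv x) - q * (u x + e) powr (- q - 1) * (Du x \<bullet> Du x)"
      unfolding right_diff_distrib using key[OF v0[OF xc], of "Dv x"] key[OF ue[OF xc], of "Du x"] by simp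
    then have E: "E x = real (n + 2) * max 0 (?A x - ?B x) ^ (n + 1) * ((?Y x - ?X x) \<bullet> (?Y x - ?X x))
        - ?\<phi> x * (q * v x powr (- q - 1) * (Dv x \<bullet> Dv x) - q * (u x + e) powr (- q - 1) * (Du x \<bullet> Du x))"
      unfolding E_def picone_density_def by simp
    have gen: "f * ((- (b * s) - U) + ((- 1) * (- b - V) + 0)) + k * - N = f * (b * (1 - s)) - (k * N - f * (V - U))"
      for f b s U V k N :: real
      by (simp add: algebra_simps)
    have neg: "(?Y x - ?X x) \<bullet> (?X x + (- 1) *\<^sub>R ?Y x) = - ((?Y x - ?X x) \<bullet> (?Y x - ?X x))"
      by (simp add: inner_diff_right)
    show "?\<phi> x * ((- (a x * ?s x) - q * (u x + e) powr (- q - 1) * (Du x \<bullet> Du x))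
        + ((- 1) * (- a x - q * v x powr (- q - 1) * (Dv x \<bullet> Dv x)) + 0 \<bullet> ?Y x))
        + ((real (n + 2) * max 0 (?A x - ?B x) ^ (n + 1)) *\<^sub>R (?Y x - ?X x)) \<bullet> (?X x + (- 1) *\<^sub>R ?Y x)
        = ?f x"
      unfolding E inner_scaleR_left inner_zero_left neg by (rule gen)
  qed
  have cA: "continuous_on (closure \<Omega>) ?A" and cB: "continuous_on (closure \<Omega>) ?B"
    and cY: "continuous_on (closure \<Omega>) ?Y" and cX: "continuous_on (closure \<Omega>) ?X"
    using gA gB unfolding has_grad_def by blast+
  have A0: "0 < ?A x" and B0: "0 < ?B x" if "x \<in> closure \<Omega>" for x
    using v0[OF that] ue[OF that] q by auto
  have cs: "continuous_on (closure \<Omega>) ?s"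
    using u0 ue q by (intro continuous_intros continuous_on_powr' cont) (auto simp: less_imp_le less_imp_neq[symmetric])
  have nz: "\<forall>x\<in>closure \<Omega>. ?A x \<noteq> 0" "\<forall>x\<in>closure \<Omega>. ?B x \<noteq> 0"
    using A0 B0 by (metis less_irrefl)+
  have cE: "continuous_on (closure \<Omega>) E"
    unfolding E_def by (intro continuous_on_picone_density cA cB cX cY nz)
  have c\<phi>: "continuous_on (closure \<Omega>) ?\<phi>"
    using gD unfolding has_grad_def by blast
  have cf: "continuous_on (closure \<Omega>) ?f"
    by (intro continuous_on_diff continuous_on_mult continuous_on_const c\<phi> a cs cE)
  show E_int: "E integrable_on \<Omega>"
    by (rule continuous_on_closure_integrable[OF op bdd cE])
  \<comment> \<open>The orientation \<open>?X - ?Y\<close> gives the flux its sign: the condition on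
    \<open>u\<close> contributes a nonnegative amount and the Neumann condition on \<open>v\<close>
    contributes zero.\<close>
  have "0 \<le> integral \<Omega> ?f"
  proof (rule flux_nonneg[OF dom div cf])
    fix x assume x: "x \<in> frontier \<Omega>"
    then have "0 \<le> u x"
      using u0 by (auto simp: frontier_def)
    then have "0 \<le> ?X x \<bullet> grad \<rho> x"
      using bu[OF x] \<alpha> by simp
    moreover have "?Y x \<bullet> grad \<rho> x = 0"
      unfolding inner_scaleR_left bv[OF x] by simp
    ultimately have "0 \<le> ?\<phi> x * (?X x \<bullet> grad \<rho> x + (- 1) * (?Y x \<bullet> grad \<rho> x))"
      by (intro mult_nonneg_nonneg zero_le_power) auto
    then show "0 \<le> ?F x \<bullet> grad \<rho> x"
      unfolding inner_scaleR_left inner_add_left .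
  qed
  also have "\<dots> \<le> integral \<Omega> (\<lambda>x. M ^ (n + 2) * (max 0 (a x) * (1 - ?s x)) - E x)"
  proof (rule integral_le)
    show "?f integrable_on \<Omega>"
      by (rule continuous_on_closure_integrable[OF op bdd cf])
    show "(\<lambda>x. M ^ (n + 2) * (max 0 (a x) * (1 - ?s x)) - E x) integrable_on \<Omega>"
      by (intro integrable_diff integrable_on_mult_right T E_int)
    fix x assume "x \<in> \<Omega>"
    then have xc: "x \<in> closure \<Omega>" using closure_subset by blast
    have s: "0 \<le> ?s x" "?s x \<le> 1"
      using weight_bounds[OF u0[OF xc] e q(1)] by auto
    \<comment> \<open>Positivity of \<open>?B x\<close> bounds the difference by
      \<open>?A x\<close>, hence by \<open>M\<close>, independently of \<open>e\<close>.\<close>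
    have "max 0 (?A x - ?B x) \<le> M"
      using A0[OF xc] B0[OF xc] M[OF xc] by auto
    then have "?\<phi> x \<le> M ^ (n + 2)"
      by (intro power_mono) auto
    then have "?\<phi> x * (max 0 (a x) * (1 - ?s x)) \<le> M ^ (n + 2) * (max 0 (a x) * (1 - ?s x))"
      using s by (intro mult_right_mono mult_nonneg_nonneg) auto
    moreover have "?\<phi> x * (a x * (1 - ?s x)) \<le> ?\<phi> x * (max 0 (a x) * (1 - ?s x))"
      using s by (intro mult_left_mono mult_right_mono zero_le_power) auto
    ultimately show "?f x \<le> M ^ (n + 2) * (max 0 (a x) * (1 - ?s x)) - E x"
      by linarith
  qed
  also have "\<dots> = M ^ (n + 2) * integral \<Omega> (\<lambda>x. max 0 (a x) * (1 - ?s x)) - integral \<Omega> E"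
    by (subst integral_diff[OF integrable_on_mult_right[OF T] E_int]) simp
  finally show "integral \<Omega> E \<le> M ^ (n + 2) * integral \<Omega> (\<lambda>x. max 0 (a x) * (1 - ?s x))"
    by simp
qed

section \<open>Vanishing gradients and comparison of the two solutions\<close>

lemma has_grad_0_const_on_ball:
  assumes "has_grad \<Omega> g G" and sub: "ball x r \<subseteq> \<Omega>" and zero: "\<And>y. y \<in> ball x r \<Longrightarrow> G y = 0"
    and y: "y \<in> ball x r"
  shows "g y = g x"
proof (rule has_derivative_zero_unique[OF convex_ball _ y])
  show "x \<in> ball x r"
    using y by (metis ball_eq_empty centre_in_ball empty_iff not_less)
  fix z assume z: "z \<in> ball x r"
  then have "(g has_derivative (\<lambda>h. G z \<bullet> h)) (at z)"
    using assms(1) sub unfolding has_grad_def by blast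
  then show "(g has_derivative (\<lambda>h. 0)) (at z within ball x r)"
    using zero[OF z] has_derivative_at_withinI by fastforce
qed

text \<open>Covers the zeros of a nonnegative solution, where the argument with the Picone density,
  which requires \<open>0 < u y\<close>, gives no information.\<close>

lemma has_grad_0_at_min:
  assumes "open \<Omega>" and g: "has_grad \<Omega> g G" and x: "x \<in> \<Omega>" and "\<And>y. y \<in> \<Omega> \<Longrightarrow> g x \<le> g y"
  shows "G x = 0"
proof -
  have "(g has_derivative (\<lambda>h. G x \<bullet> h)) (at x)"
    using g x unfolding has_grad_def by blast
  then have "(\<lambda>h. G x \<bullet> h) = (\<lambda>h. 0)"
    using assms by (intro differential_zero_maxmin[OF x]) auto
  then show ?thesis
    by (metis inner_eq_zero_iff)
qed

text \<open>The integrals of the nonnegative densities are bounded by multiples of the defect, which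
  tend to 0, so both gradients vanish where \<open>0 < u < v\<close>. A clopen argument then spreads
  the constancy of \<open>u\<close> from one point with \<open>u < v\<close> to all of
  \<open>\<Omega>\<close>.\<close>

lemma solution_ge_neumann_solution:
  fixes \<Omega> :: "'a::euclidean_space set"
  assumes dom: "smooth_domain \<Omega> \<rho>" and a: "continuous_on (closure \<Omega>) a"
    and a_pos: "\<exists>x\<in>\<Omega>. a x > 0" and \<alpha>: "\<alpha> \<ge> 0" and q: "0 < q" "q < 1"
    and solu: "is_solution \<Omega> \<rho> a \<alpha> q u" and pos: "\<And>x. x \<in> \<Omega> \<Longrightarrow> a x > 0 \<Longrightarrow> u x > 0"
    and solv: "is_solution \<Omega> \<rho> a 0 q v" and v0: "\<And>x. x \<in> closure \<Omega> \<Longrightarrow> 0 < v x"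
    and x: "x \<in> closure \<Omega>"
  shows "v x \<le> u x"
proof -
  have op: "open \<Omega>" and bdd: "bounded \<Omega>" and conn: "connected \<Omega>"
    using dom unfolding smooth_domain_def by auto
  obtain Du where gu: "has_grad \<Omega> u Du" and du: "has_div \<Omega> Du (\<lambda>x. - (a x * u x powr q))"
    and u0: "\<And>x. x \<in> closure \<Omega> \<Longrightarrow> 0 \<le> u x"
    and bu: "\<And>x. x \<in> frontier \<Omega> \<Longrightarrow> Du x \<bullet> grad \<rho> x = \<alpha> * u x * norm (grad \<rho> x)"
    by (rule is_solutionE[OF dom solu]) (rule that; blast)
  obtain Dv where gv: "has_grad \<Omega> v Dv" and dv: "has_div \<Omega> Dv (\<lambda>x. - (a x * v x powr q))"
    and bv: "\<And>x. x \<in> frontier \<Omega> \<Longrightarrow> Dv x \<bullet> grad \<rho> x = 0 * v x * norm (grad \<rho> x)"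
    by (rule is_solutionE[OF dom solv]) (rule that; blast)
  have cont: "continuous_on (closure \<Omega>) u" "continuous_on (closure \<Omega>) Du"
    "continuous_on (closure \<Omega>) v" "continuous_on (closure \<Omega>) Dv"
    using gu gv unfolding has_grad_def by blast+
  have bv0: "Dv x \<bullet> grad \<rho> x = 0" if "x \<in> frontier \<Omega>" for x
    using bv[OF that] by simp
  have inc: "y \<in> closure \<Omega>" if "y \<in> \<Omega>" for y
    using that closure_subset by blast
  \<comment> \<open>The filter \<open>nhds y\<close>, rather than \<open>at y\<close>, permits
    composition with \<open>snd\<close>, which may take the value \<open>y\<close> itself.\<close>
  have lim: "(f \<longlongrightarrow> f y) (nhds y)" if "continuous_on (closure \<Omega>) f" "y \<in> \<Omega>" for f :: "'a \<Rightarrow> 'b::real_normed_vector" and y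
    using continuous_on_subset[OF that(1) closure_subset] that(2) op
    by (auto simp: continuous_on_eq_continuous_at continuous_at tendsto_at_iff_tendsto_nhds)
  define c where "c = q / (1 - q)"
  have c: "0 < c" using q by (simp add: c_def)
  obtain n :: nat where "c < real n"
    using reals_Archimedean2 by blast
  then have n: "c < real (n + 2)" by simp
  let ?A = "\<lambda>x. v x powr (1 - q) / (1 - q)" and ?B = "\<lambda>e x. (u x + e) powr (1 - q) / (1 - q)"
  define E where "E e x = picone_density n c (?A x) (?B e x) (v x powr (- q) *\<^sub>R Dv x) ((u x + e) powr (- q) *\<^sub>R Du x)" for e x
  define \<epsilon> where "\<epsilon> k = inverse (real (Suc k))" for k
  have \<epsilon>: "\<epsilon> k > 0" for k by (auto simp: \<epsilon>_def)
  have \<epsilon>_lim: "\<epsilon> \<longlonglongrightarrow> 0" unfolding \<epsilon>_def by (rule LIMSEQ_inverse_real_of_nat)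
  let ?T = "\<lambda>k x. max 0 (a x) * (1 - u x powr q * (u x + \<epsilon> k) powr (- q))"
  note T = integral_defect_tendsto_0[where \<epsilon> = \<epsilon>, OF op bdd q(1) a cont(1) u0 pos \<epsilon> \<epsilon>_lim]
  have "continuous_on (closure \<Omega>) ?A"
    using v0 q by (intro continuous_intros cont) (auto simp: less_imp_neq[symmetric])
  then obtain M where M: "\<And>x. x \<in> closure \<Omega> \<Longrightarrow> norm (?A x) \<le> M"
    using bounded_on_closure[OF bdd] by blast
  have E_int: "E (\<epsilon> k) integrable_on \<Omega>"
    and E_le: "integral \<Omega> (E (\<epsilon> k)) \<le> M ^ (n + 2) * integral \<Omega> (?T k)" for k
  proof -
    have "?A x \<le> M" if "x \<in> closure \<Omega>" for x
      using M[OF that] q by simp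
    note * = integral_picone_density_le[OF dom a \<alpha> q gu du u0 bu gv dv v0 bv0 \<epsilon> this T(1), where n = n]
    show "E (\<epsilon> k) integrable_on \<Omega>" "integral \<Omega> (E (\<epsilon> k)) \<le> M ^ (n + 2) * integral \<Omega> (?T k)"
      unfolding E_def c_def by (rule *; assumption)+
  qed
  \<comment> \<open>Otherwise the density at shift 0 is positive at \<open>y\<close>. Joint
    continuity in shift and point keeps it above some \<eta> on a fixed ball for all small shifts,
    so its integrals cannot be bounded by a null sequence.\<close>
  have critical: "Du y = 0 \<and> Dv y = 0" if y: "y \<in> \<Omega>" and uv: "0 < u y" "u y < v y" for y
  proof (rule ccontr)
    assume "\<not> (Du y = 0 \<and> Dv y = 0)"
    then have "0 < E 0 y"
      unfolding E_def using uv q c n by (intro picone_density_pos divide_strict_right_mono powr_less_mono2) auto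
    then obtain \<eta> where \<eta>: "0 < \<eta>" "\<eta> < E 0 y"
      using dense by blast
    have snd: "((\<lambda>z. f (snd z)) \<longlongrightarrow> f y) (at (0, y))" if "continuous_on (closure \<Omega>) f"
      for f :: "'a \<Rightarrow> 'b::real_normed_vector"
      by (rule filterlim_compose[OF lim[OF that y]]) (auto intro!: tendsto_eq_intros)
    have fst: "(fst \<longlongrightarrow> 0) (at (0 :: real, y))"
      by (auto intro!: tendsto_eq_intros)
    have "((\<lambda>z. E (fst z) (snd z)) \<longlongrightarrow> E 0 y) (at (0, y))"
      unfolding E_def using uv q
      by (intro tendsto_picone_density tendsto_intros snd cont fst) auto
    then have "\<forall>\<^sub>F z in at (0, y). \<eta> < E (fst z) (snd z)"
      using \<eta>(2) by (rule order_tendstoD)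
    then obtain d where d: "d > 0" "\<And>z. z \<noteq> (0, y) \<Longrightarrow> dist z (0, y) < d \<Longrightarrow> \<eta> < E (fst z) (snd z)"
      unfolding eventually_at by auto
    obtain r where r: "r > 0" "cball y r \<subseteq> \<Omega>"
      using op y open_contains_cball by blast
    \<comment> \<open>Together with \<open>\<epsilon> k < d / 3\<close> this keeps the pair
      \<open>(\<epsilon> k, z)\<close> within distance \<open>2 * d / 3\<close> of
      \<open>(0, y)\<close>.\<close>
    define r' where "r' = min r (d / 3)"
    have r': "r' > 0" "cball y r' \<subseteq> \<Omega>" "r' \<le> d / 3"
      using r d(1) by (auto simp: r'_def)
    have "\<forall>\<^sub>F k in sequentially. \<epsilon> k < d / 3"
      using \<epsilon>_lim d(1) by (intro order_tendstoD) auto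
    then have "\<forall>\<^sub>F k in sequentially. \<eta> * measure lborel (cball y r') \<le> M ^ (n + 2) * integral \<Omega> (?T k)"
    proof eventually_elim
      case (elim k)
      have "\<eta> \<le> E (\<epsilon> k) z" if z: "z \<in> cball y r'" for z
      proof -
        have "dist (\<epsilon> k, z) (0, y) \<le> dist (\<epsilon> k) 0 + dist z y"
          unfolding dist_Pair_Pair by (rule sqrt_sum_squares_le_sum) auto
        also have "\<dots> < d"
          using z elim r'(3) \<epsilon>[of k] d(1) by (simp add: dist_commute)
        finally show ?thesis
          using d(2)[of "(\<epsilon> k, z)"] \<epsilon>[of k] by simp
      qed
      moreover have "0 \<le> E (\<epsilon> k) z" if "z \<in> \<Omega>" for z
        unfolding E_def using v0[OF inc[OF that]] u0[OF inc[OF that]] \<epsilon>[of k] q c n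
        by (intro picone_density_nonneg divide_pos_pos) auto
      ultimately have "\<eta> * measure lborel (cball y r') \<le> integral \<Omega> (E (\<epsilon> k))"
        using r'(2) by (intro integral_ge_cball E_int) auto
      with E_le[of k] show ?case by linarith
    qed
    moreover have "(\<lambda>k. M ^ (n + 2) * integral \<Omega> (?T k)) \<longlonglongrightarrow> M ^ (n + 2) * 0"
      by (intro tendsto_mult_left T(2))
    ultimately have "\<eta> * measure lborel (cball y r') \<le> M ^ (n + 2) * 0"
      by (intro tendsto_lowerbound) auto
    moreover have "0 < \<eta> * measure lborel (cball y r')"
      using \<eta>(1) content_cball_pos[OF r'(1), of y] by simp
    ultimately show False by simp
  qed
  have "v y \<le> u y" if y: "y \<in> \<Omega>" for y
  proof (rule ccontr)
    assume "\<not> v y \<le> u y"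
    \<comment> \<open>If \<open>u y > 0\<close>, both functions are kept constant on
      \<open>S\<close>, so \<open>u < v\<close> persists there. If \<open>u y = 0\<close>, the
      gradient of \<open>v\<close> is not controlled, but \<open>u < v\<close> persists on
      \<open>S\<close> because \<open>v\<close> is positive.\<close>
    define S where "S = {z \<in> \<Omega>. u z = u y \<and> (u y = 0 \<or> v z = v y)}"
    have "\<exists>r>0. ball z r \<subseteq> S" if z: "z \<in> S" for z
    proof -
      have z\<Omega>: "z \<in> \<Omega>" and uz: "u z = u y" and uvz: "u z < v z"
        using z v0[OF inc, of z] \<open>\<not> v y \<le> u y\<close> by (auto simp: S_def)
      have "\<forall>\<^sub>F t in nhds z. 0 < v t - u t"
        using uvz by (intro order_tendstoD(1)[OF tendsto_diff[OF lim[OF cont(3) z\<Omega>] lim[OF cont(1) z\<Omega>]]]) simp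
      then have "\<forall>\<^sub>F t in nhds z. u t < v t \<and> t \<in> \<Omega>"
        using eventually_nhds_in_open[OF op z\<Omega>] by eventually_elim simp
      then obtain r where r: "r > 0" "\<And>t. t \<in> ball z r \<Longrightarrow> u t < v t \<and> t \<in> \<Omega>"
        unfolding eventually_nhds_metric by (auto simp: dist_commute)
      \<comment> \<open>Zeros of \<open>u\<close> are minima; at the remaining points of the ball
        \<open>0 < u t < v t\<close>, so \<open>critical\<close> applies.\<close>
      have "Du t = 0" if "t \<in> ball z r" for t
      proof (cases "u t = 0")
        case True
        then show ?thesis
          using r(2)[OF that] u0 inc by (intro has_grad_0_at_min[OF op gu]) auto
      next
        case False
        then show ?thesis
          using critical[of t] r(2)[OF that] u0[OF inc, of t] by auto
      qed
      then have const_u: "u t = u y" if "t \<in> ball z r" for t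
        using has_grad_0_const_on_ball[OF gu _ _ that] r(2) uz by fastforce
      have "v t = v y" if "u y \<noteq> 0" "t \<in> ball z r" for t
      proof -
        have "Dv w = 0" if w: "w \<in> ball z r" for w
          using critical[of w] r(2)[OF w] u0[OF inc, of w] const_u[OF w] \<open>u y \<noteq> 0\<close> by auto
        then have "v t = v z"
          using has_grad_0_const_on_ball[OF gv _ _ that(2)] r(2) by blast
        then show ?thesis
          using z \<open>u y \<noteq> 0\<close> by (simp add: S_def)
      qed
      then have "ball z r \<subseteq> S"
        using const_u r(2) unfolding S_def by blast
      then show ?thesis using r(1) by blast
    qed
    then have "open S"
      unfolding open_contains_ball by blast
    then have "openin (top_of_set \<Omega>) S"
      by (auto simp: openin_open_eq[OF op] S_def)
    moreover have "closedin (top_of_set \<Omega>) S"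
    proof -
      have cl: "closedin (top_of_set \<Omega>) {z \<in> \<Omega>. f z = s}" if "continuous_on (closure \<Omega>) f" for f :: "'a \<Rightarrow> real" and s
        using continuous_on_subset[OF that closure_subset] by (rule continuous_closedin_preimage_constant)
      have "S = {z \<in> \<Omega>. u z = u y} \<inter> (if u y = 0 then \<Omega> else {z \<in> \<Omega>. v z = v y})"
        by (auto simp: S_def)
      then show ?thesis
        using cl[OF cont(1)] cl[OF cont(3)] by (auto intro!: closedin_Int)
    qed
    moreover have "y \<in> S" using y by (simp add: S_def)
    ultimately have "S = \<Omega>"
      using conn unfolding connected_clopen by blast
    then have u_const: "u z = u y" if "z \<in> \<Omega>" for z
      using that unfolding S_def by blast
    then have "Du z = 0" if "z \<in> \<Omega>" for z
      using that by (intro has_grad_0_at_min[OF op gu]) auto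
    then have "- (a z * u z powr q) = 0" if "z \<in> \<Omega>" for z
      using has_div_locally_constant[OF op du _ that] by blast
    then show False
      using a_pos pos by fastforce
  qed
  then have "0 \<le> u y - v y" if "y \<in> \<Omega>" for y
    using that by simp
  then have "0 \<le> u x - v x"
    by (rule continuous_ge_on_closure[OF continuous_on_diff[OF cont(1) cont(3)] x])
  then show ?thesis by simp
qed

theorem theorem1p1:
  fixes \<Omega> :: "'a::euclidean_space set" and \<rho> a u :: "'a \<Rightarrow> real" and \<theta> \<alpha> q :: real
  assumes dom: "smooth_domain \<Omega> \<rho>"
    and th: "0 < \<theta>" "\<theta> < 1"
    and a_holder: "holder_on \<theta> (closure \<Omega>) a"
    and a_sign: "\<exists>x\<in>\<Omega>. a x > 0" "\<exists>x\<in>\<Omega>. a x < 0"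
    and alpha: "\<alpha> \<ge> 0"
    and q: "0 < q" "q < 1"
    and sol: "is_solution \<Omega> \<rho> a \<alpha> q u"
    and pos: "\<forall>x\<in>{x\<in>\<Omega>. a x > 0}. u x > 0"
  shows "integral \<Omega> a < 0 \<and>
    ((finite (components {x\<in>\<Omega>. a x > 0}) \<and>
      (\<forall>C\<in>components {x\<in>\<Omega>. a x > 0}. \<exists>\<sigma>. smooth_domain C \<sigma>) \<and>
      q \<in> I_N \<Omega> \<rho> a) \<longrightarrow> u \<in> positive_cone \<Omega>)"
proof (intro conjI impI)
  have a: "continuous_on (closure \<Omega>) a"
    using holder_on_continuous_on[OF a_holder th(1)] .
  have pos': "u x > 0" if "x \<in> \<Omega>" "a x > 0" for x
    using pos that by blast
  show "integral \<Omega> a < 0"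
    by (rule integral_weight_neg[OF dom a a_sign(1) alpha q(1) sol pos'])
  assume "finite (components {x\<in>\<Omega>. a x > 0}) \<and>
      (\<forall>C\<in>components {x\<in>\<Omega>. a x > 0}. \<exists>\<sigma>. smooth_domain C \<sigma>) \<and> q \<in> I_N \<Omega> \<rho> a"
  then obtain v where v: "is_solution \<Omega> \<rho> a 0 q v" "v \<in> positive_cone \<Omega>"
    unfolding I_N_def by blast
  have v0: "0 < v x" if "x \<in> closure \<Omega>" for x
    using v(2) that unfolding positive_cone_def by blast
  have "0 < u x" if "x \<in> closure \<Omega>" for x
    using solution_ge_neumann_solution[OF dom a a_sign(1) alpha q sol pos' v(1) v0 that] v0[OF that] by linarith
  moreover have "continuous_on (closure \<Omega>) u"
    using sol unfolding is_solution_def C2r_data_def by blast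
  ultimately show "u \<in> positive_cone \<Omega>"
    unfolding positive_cone_def by blast
qed

end
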